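(* For $n\ge 1$ let $\mathbf{T}_n=(a_{|j-k|})_{0\le j,k\le n}$ be the random symmetric Toeplitz matrix built from a sequence $(a_j)_{j\ge 0}$ of i.i.d.\ real random variables with $\mathrm{Var}(a_0)=1$. With probability one, the empirical eigenvalue distribution $\mu(n^{-1/2}\mathbf{T}_n)$ converges weakly as $n\to\infty$ to a nonrandom symmetric probability measure $\gamma$ on $\mathbb R$ which does not depend on the distribution of $a_0$; this convergence is a known result due to Bryc, Dembo and Jiang and serves only to define $\gamma$. Then $\gamma$ is absolutely continuous with respect to Lebesgue measure, and its density is bounded by $8$ (indeed by $16\sqrt2/\pi$).
   Context: For an $m\times m$ Hermitian matrix $\mathbf{A}$ with eigenvalues $\lambda_1,\dots,\lambda_m$ (counted with multiplicity), the empirical eigenvalue distribution is $\mu(\mathbf{A})=\frac1m\sum_{i=1}^m\delta_{\lambda_i}$. *)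

theory Defs
  imports "HOL-Probability.Probability" "Jordan_Normal_Form.Char_Poly"
begin

text \<open>Eigenvalues of a real square matrix, counted with (algebraic) multiplicity,
  as the multiset of real roots of its characteristic polynomial. For real
  symmetric matrices all roots are real, so this multiset has size equal to the dimension.\<close>
definition eigenvalues_mset :: "real mat \<Rightarrow> real multiset" where
  "eigenvalues_mset A = proots (char_poly A)"

definition empirical_eigen_dist :: "real mat \<Rightarrow> real measure" where
  "empirical_eigen_dist A = distr (measure_pmf (pmf_of_multiset (eigenvalues_mset A))) borel id"

definition toeplitz_mat :: "(nat \<Rightarrow> real) \<Rightarrow> nat \<Rightarrow> real mat" where
  "toeplitz_mat a n = mat (n+1) (n+1) (\<lambda>(j,k). a (if j \<le> k then k - j else j - k))"

end

theory Submission
  imports Defs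
begin

text \<open>
  The idea is spectral averaging, after Sen and Virag. With \<open>N = n + 1\<close>, the real parts
  \<open>K_j = (1/N) cos (2 pi j (i - k) / N)\<close> of the discrete Fourier projections are Toeplitz of
  rank at most two and add up to the identity. Hence the trace of \<open>- Im (z - T/sqrt n)^{-1}\<close> is the sum of
  the traces against the \<open>K_j\<close>, and moving the entries in the direction of \<open>K_j\<close> is a finite rank
  perturbation along which the integral of the corresponding trace is at most \<open>2 pi\<close>.
  For Gaussian entries the law is quasi-invariant under such shifts, which turns this into
  a bound on the expected Poisson integral of the spectral measure, uniform in \<open>n\<close> and \<open>z\<close>.
  A Lindeberg replacement of the given entries by Gaussian ones with the same mean and variance
  transfers the bound to the limit \<open>\<gamma>\<close>, and a measure whose Poisson integrals are bounded
  by \<open>pi C\<close> has density at most \<open>C\<close>. The argument gives \<open>C = 2 exp (1/2)\<close>.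
\<close>

unbundle no vec_syntax and no inner_syntax

subsection \<open>Resolvents of symmetric matrices\<close>

text \<open>The given law may be discrete, and a shifted discrete law can be singular to the
  original, so no averaging along a direction is possible before Gaussian entries have taken over.
  An expectation is enough: the limit is nonrandom and the normalised trace is at most
  \<open>1 / Im z\<close>, so almost sure convergence passes to means. As only two moments exist,
  the error of replacing one entry is kept in the form \<open>min (x^2) (s * |x|^3)\<close>.

  The scaling makes the bound uniform in \<open>n\<close>. To move \<open>T / sqrt n\<close> by
  \<open>t K_j\<close>, the entries move by \<open>t\<close> times a vector with coordinates at most
  \<open>sqrt n / N\<close>, whose squared length is at most \<open>n / N\<close>, hence at most 1.
  For \<open>t\<close> in \<open>[-1, 1]\<close> the Gaussian weight is then under control.

  The constant: the integral over \<open>t\<close> is at most \<open>2 pi\<close>, one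
  \<open>pi\<close> for each of two eigenvalues of a 2 by 2 matrix; the weight is majorised by two
  exponentials, each of mean at most \<open>exp (1/2)\<close>; the interval \<open>[-1, 1]\<close>
  has length 2. So the Poisson integral is at most \<open>2 pi exp (1/2)\<close>, and dividing by
  \<open>pi\<close> gives about 3.3, below both required bounds.\<close>

definition matrix_trace :: "'a::comm_monoid_add mat \<Rightarrow> 'a" where
  "matrix_trace A = (\<Sum>i<dim_row A. A $$ (i,i))"

definition vnorm :: "complex vec \<Rightarrow> real" where
  "vnorm v = L2_set (\<lambda>i. cmod (v $ i)) {..<dim_vec v}"

abbreviation cmat :: "real mat \<Rightarrow> complex mat" where
  "cmat \<equiv> map_mat complex_of_real"

definition shift_mat :: "real mat \<Rightarrow> complex \<Rightarrow> complex mat" where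
  "shift_mat H z = z \<cdot>\<^sub>m 1\<^sub>m (dim_row H) - cmat H"

text \<open>The adjugate formula makes the inverse total and its entries rational in those of
  \<open>H\<close>. Measurability then reduces to that of determinants, and the trace becomes a
  logarithmic derivative of the characteristic polynomial.\<close>

definition resolvent :: "real mat \<Rightarrow> complex \<Rightarrow> complex mat" where
  "resolvent H z = (1 / det (shift_mat H z)) \<cdot>\<^sub>m adj_mat (shift_mat H z)"

definition symm_mats :: "nat \<Rightarrow> real mat set" where
  "symm_mats N = {H \<in> carrier_mat N N. transpose_mat H = H}"

lemma symm_mats_carrier: "H \<in> symm_mats N \<Longrightarrow> H \<in> carrier_mat N N"
  by (simp add: symm_mats_def)

lemma symm_mats_index:
  assumes "H \<in> symm_mats N" "i < N" "j < N"
  shows "H $$ (i,j) = H $$ (j,i)"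
proof -
  have "transpose_mat H $$ (i,j) = H $$ (j,i)"
    using assms symm_mats_carrier[OF assms(1)] by simp
  moreover have "transpose_mat H = H" using assms(1) by (simp add: symm_mats_def)
  ultimately show ?thesis by simp
qed

lemma symm_matsI:
  assumes "H \<in> carrier_mat N N" "\<And>i j. i < N \<Longrightarrow> j < N \<Longrightarrow> H $$ (i,j) = H $$ (j,i)"
  shows "H \<in> symm_mats N"
  unfolding symm_mats_def using assms by (auto intro!: eq_matI)

lemma shift_mat_carrier [simp]:
  "H \<in> carrier_mat N N \<Longrightarrow> shift_mat H z \<in> carrier_mat N N"
  by (auto simp: shift_mat_def)

lemma index_mult_mat_vec_sum:
  assumes "A \<in> carrier_mat N N" "v \<in> carrier_vec N" "i < N"
  shows "(A *\<^sub>v v) $ i = (\<Sum>j<N. A $$ (i,j) * v $ j)"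
  using assms by (auto simp: scalar_prod_def lessThan_atLeast0)

lemma shift_mat_mult_vec:
  assumes "H \<in> carrier_mat N N" "v \<in> carrier_vec N" "i < N"
  shows "(shift_mat H z *\<^sub>v v) $ i = z * v $ i - (\<Sum>j<N. of_real (H $$ (i,j)) * v $ j)"
proof -
  have "(shift_mat H z *\<^sub>v v) $ i = (\<Sum>j<N. shift_mat H z $$ (i,j) * v $ j)"
    using assms by (intro index_mult_mat_vec_sum) auto
  also have "\<dots> = (\<Sum>j<N. (if i = j then z * v $ j else 0) - of_real (H $$ (i,j)) * v $ j)"
    using assms by (intro sum.cong) (auto simp: shift_mat_def algebra_simps)
  also have "\<dots> = z * v $ i - (\<Sum>j<N. of_real (H $$ (i,j)) * v $ j)"
    using assms by (simp add: sum_subtractf)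
  finally show ?thesis .
qed

lemma vnorm_nonneg [simp]: "0 \<le> vnorm v"
  by (simp add: vnorm_def)

lemma vnorm_square:
  assumes "v \<in> carrier_vec N"
  shows "(vnorm v)^2 = (\<Sum>i<N. (cmod (v $ i))^2)"
  using assms by (auto simp: vnorm_def L2_set_def sum_nonneg)

lemma cmod_index_le_vnorm:
  assumes "v \<in> carrier_vec N" "i < N"
  shows "cmod (v $ i) \<le> vnorm v"
  unfolding vnorm_def using assms by (intro member_le_L2_set) auto

text \<open>The quadratic form of a real symmetric matrix is real, so only \<open>z\<close>
  contributes. This one identity yields invertibility, the norm of the resolvent, the reality of
  eigenvalues and the sign of the energies below.\<close>

lemma Im_shift_mat_form:
  assumes H: "H \<in> symm_mats N" and v: "v \<in> carrier_vec N"
  shows "Im (\<Sum>i<N. cnj (v $ i) * (shift_mat H z *\<^sub>v v) $ i) = Im z * (vnorm v)^2"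
proof -
  let ?q = "\<Sum>i<N. \<Sum>j<N. cnj (v $ i) * of_real (H $$ (i,j)) * v $ j"
  have "cnj ?q = (\<Sum>i<N. \<Sum>j<N. cnj (v $ j) * of_real (H $$ (i,j)) * v $ i)"
    by (simp add: mult_ac)
  also have "\<dots> = (\<Sum>j<N. \<Sum>i<N. cnj (v $ j) * of_real (H $$ (i,j)) * v $ i)"
    by (rule sum.swap)
  also have "\<dots> = ?q"
    using symm_mats_index[OF H] by (intro sum.cong) auto
  finally have q: "Im ?q = 0"
    using Reals_cnj_iff complex_is_Real_iff by blast
  have "(\<Sum>i<N. cnj (v $ i) * (shift_mat H z *\<^sub>v v) $ i) =
      (\<Sum>i<N. z * of_real ((cmod (v $ i))^2)) - ?q"
  proof (subst sum_subtractf[symmetric], intro sum.cong refl)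
    fix i assume "i \<in> {..<N}"
    then have "cnj (v $ i) * (shift_mat H z *\<^sub>v v) $ i
        = z * (v $ i * cnj (v $ i)) - cnj (v $ i) * (\<Sum>j<N. of_real (H $$ (i,j)) * v $ j)"
      by (subst shift_mat_mult_vec[OF symm_mats_carrier[OF H] v]) (simp_all add: algebra_simps)
    then show "cnj (v $ i) * (shift_mat H z *\<^sub>v v) $ i = z * of_real ((cmod (v $ i))^2)
        - (\<Sum>j<N. cnj (v $ i) * of_real (H $$ (i,j)) * v $ j)"
      by (simp only: complex_norm_square sum_distrib_left mult.assoc)
  qed
  also have "\<dots> = z * of_real ((vnorm v)^2) - ?q"
    by (simp add: vnorm_square[OF v] sum_distrib_left)
  finally show ?thesis using q by simp
qed

lemma cmod_sum_cnj_mult_le: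
  assumes "v \<in> carrier_vec N" "w \<in> carrier_vec N"
  shows "cmod (\<Sum>i<N. cnj (v $ i) * w $ i) \<le> vnorm v * vnorm w"
proof -
  have "cmod (\<Sum>i<N. cnj (v $ i) * w $ i) \<le> (\<Sum>i<N. \<bar>cmod (v $ i)\<bar> * \<bar>cmod (w $ i)\<bar>)"
    by (rule order_trans[OF norm_sum]) (simp add: norm_mult)
  also have "\<dots> \<le> vnorm v * vnorm w"
    using L2_set_mult_ineq[of "\<lambda>i. cmod (v $ i)" "\<lambda>i. cmod (w $ i)" "{..<N}"] assms
    by (simp add: vnorm_def)
  finally show ?thesis .
qed

text \<open>Cauchy-Schwarz applied to the form in \<open>Im_shift_mat_form\<close>. The bound comes
  without diagonalising \<open>H\<close>.\<close>

lemma vnorm_le_shift_mat: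
  assumes H: "H \<in> symm_mats N" and v: "v \<in> carrier_vec N" and z: "Im z > 0"
  shows "vnorm v \<le> vnorm (shift_mat H z *\<^sub>v v) / Im z"
proof (cases "vnorm v = 0")
  case False
  then have pos: "vnorm v > 0" using vnorm_nonneg[of v] by linarith
  have "Im z * (vnorm v)^2 \<le> cmod (\<Sum>i<N. cnj (v $ i) * (shift_mat H z *\<^sub>v v) $ i)"
    unfolding Im_shift_mat_form[OF H v, of z, symmetric]
    using abs_Im_le_cmod abs_le_D1 by blast
  also have "\<dots> \<le> vnorm v * vnorm (shift_mat H z *\<^sub>v v)"
    using v shift_mat_carrier[OF symm_mats_carrier[OF H], of z]
    by (intro cmod_sum_cnj_mult_le mult_mat_vec_carrier)
  finally show ?thesis using pos z by (simp add: field_simps power2_eq_square)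
qed (use z in auto)

lemma vnorm_eq_0D:
  assumes "v \<in> carrier_vec N" "vnorm v = 0" shows "v = 0\<^sub>v N"
proof (rule eq_vecI)
  fix i assume "i < dim_vec (0\<^sub>v N :: complex vec)"
  then show "v $ i = 0\<^sub>v N $ i"
    using cmod_index_le_vnorm[OF assms(1), of i] assms(2) by auto
qed (use assms in auto)

lemma vnorm_zero [simp]: "vnorm (0\<^sub>v N) = 0"
  by (simp add: vnorm_def L2_set_def)

lemma det_shift_mat_nonzero:
  assumes H: "H \<in> symm_mats N" and z: "Im z > 0"
  shows "det (shift_mat H z) \<noteq> 0"
proof
  assume "det (shift_mat H z) = 0"
  then obtain v where v: "v \<in> carrier_vec N" "v \<noteq> 0\<^sub>v N" "shift_mat H z *\<^sub>v v = 0\<^sub>v N"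
    using det_0_iff_vec_prod_zero[OF shift_mat_carrier[OF symm_mats_carrier[OF H]]] by auto
  have "vnorm v \<le> 0"
    using vnorm_le_shift_mat[OF H v(1) z] v(3) by simp
  then have "vnorm v = 0" using vnorm_nonneg[of v] by linarith
  then show False using v vnorm_eq_0D by blast
qed

lemma resolvent_inverse:
  assumes H: "H \<in> symm_mats N" and z: "Im z > 0"
  shows "resolvent H z \<in> carrier_mat N N"
    "shift_mat H z * resolvent H z = 1\<^sub>m N"
    "resolvent H z * shift_mat H z = 1\<^sub>m N"
proof -
  note M = shift_mat_carrier[OF symm_mats_carrier[OF H], of z]
  note adj = adj_mat[OF M]
  note nz = det_shift_mat_nonzero[OF H z]
  show "resolvent H z \<in> carrier_mat N N"
    using adj(1) by (simp add: resolvent_def)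
  show "shift_mat H z * resolvent H z = 1\<^sub>m N"
    unfolding resolvent_def mult_smult_distrib[OF M adj(1)] adj(2) using nz by auto
  show "resolvent H z * shift_mat H z = 1\<^sub>m N"
    unfolding resolvent_def mult_smult_assoc_mat[OF adj(1) M] adj(3) using nz by auto
qed

lemma shift_mat_resolvent_vec:
  assumes H: "H \<in> symm_mats N" and z: "Im z > 0" and v: "v \<in> carrier_vec N"
  shows "shift_mat H z *\<^sub>v (resolvent H z *\<^sub>v v) = v"
  using resolvent_inverse[OF H z] shift_mat_carrier[OF symm_mats_carrier[OF H], of z] v
  by (metis assoc_mult_mat_vec one_mult_mat_vec)

text \<open>An upper bound for the Euclidean operator norm, stated as a relation so that no supremum
  has to be handled.\<close>

definition op_bound :: "nat \<Rightarrow> complex mat \<Rightarrow> real \<Rightarrow> bool" where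
  "op_bound N X b \<longleftrightarrow> X \<in> carrier_mat N N \<and> 0 \<le> b \<and>
     (\<forall>v \<in> carrier_vec N. vnorm (X *\<^sub>v v) \<le> b * vnorm v)"

lemma op_bound_resolvent:
  assumes H: "H \<in> symm_mats N" and z: "Im z > 0"
  shows "op_bound N (resolvent H z) (1 / Im z)"
proof -
  have "vnorm (resolvent H z *\<^sub>v v) \<le> 1 / Im z * vnorm v" if v: "v \<in> carrier_vec N" for v
  proof -
    have "resolvent H z *\<^sub>v v \<in> carrier_vec N"
      using resolvent_inverse(1)[OF H z] v by auto
    from vnorm_le_shift_mat[OF H this z] show ?thesis
      by (simp add: shift_mat_resolvent_vec[OF H z v])
  qed
  then show ?thesis using resolvent_inverse(1)[OF H z] z by (auto simp: op_bound_def)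
qed

lemma op_bound_mult:
  assumes "op_bound N X b" "op_bound N Y c"
  shows "op_bound N (X * Y) (b * c)"
proof -
  have X: "X \<in> carrier_mat N N" and Y: "Y \<in> carrier_mat N N" and b: "0 \<le> b" "0 \<le> c"
    using assms by (auto simp: op_bound_def)
  have "vnorm (X * Y *\<^sub>v v) \<le> b * c * vnorm v" if v: "v \<in> carrier_vec N" for v
  proof -
    have Yv: "Y *\<^sub>v v \<in> carrier_vec N" using Y v by auto
    have "vnorm (X * Y *\<^sub>v v) = vnorm (X *\<^sub>v (Y *\<^sub>v v))"
      using X Y v by simp
    also have "\<dots> \<le> b * vnorm (Y *\<^sub>v v)"
      using assms(1) Yv by (auto simp: op_bound_def)
    also have "\<dots> \<le> b * (c * vnorm v)"
      using assms(2) v b by (intro mult_left_mono) (auto simp: op_bound_def)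
    finally show ?thesis by simp
  qed
  then show ?thesis using X Y b by (auto simp: op_bound_def)
qed

lemma vnorm_unit_vec: "i < N \<Longrightarrow> vnorm (unit_vec N i) = 1"
proof -
  assume i: "i < N"
  have "(vnorm (unit_vec N i))^2 = (\<Sum>j<N. if j = i then 1 else 0)"
    unfolding vnorm_square[OF unit_vec_carrier] using i by (intro sum.cong) (auto simp: unit_vec_def)
  also have "\<dots> = 1" using i by simp
  finally show ?thesis using vnorm_nonneg[of "unit_vec N i"]
    by (auto simp: power2_eq_1_iff)
qed

lemma cmod_trace_le:
  assumes "op_bound N X b"
  shows "cmod (matrix_trace X) \<le> real N * b"
proof -
  have X: "X \<in> carrier_mat N N" using assms by (auto simp: op_bound_def)
  have "cmod (X $$ (i,i)) \<le> b" if i: "i < N" for i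
  proof -
    have "X $$ (i,i) = (X *\<^sub>v unit_vec N i) $ i"
      using X i by simp
    also have "cmod \<dots> \<le> vnorm (X *\<^sub>v unit_vec N i)"
      using X i by (intro cmod_index_le_vnorm) auto
    also have "\<dots> \<le> b * vnorm (unit_vec N i)"
      using assms by (auto simp: op_bound_def)
    finally show ?thesis using vnorm_unit_vec[OF i] by simp
  qed
  with X have "cmod (matrix_trace X) \<le> (\<Sum>i<dim_row X. b)"
    using X unfolding matrix_trace_def by (intro order_trans[OF norm_sum] sum_mono) simp
  with X show ?thesis by simp
qed

lemma trace_add:
  assumes "X \<in> carrier_mat N N" "Y \<in> carrier_mat N N"
  shows "matrix_trace (X + Y) = matrix_trace X + matrix_trace (Y :: 'a :: comm_monoid_add mat)"
  using assms by (auto simp: matrix_trace_def sum.distrib)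

lemma trace_smult:
  assumes "X \<in> carrier_mat N N"
  shows "matrix_trace (k \<cdot>\<^sub>m X) = k * matrix_trace (X :: 'a :: comm_ring_1 mat)"
  using assms by (auto simp: matrix_trace_def sum_distrib_left)

text \<open>Insert \<open>z - H = (z - H - x B) + x B\<close> between the two resolvents. The
  perturbed resolvent stays on the right, so the identity is exact and can be iterated.\<close>

lemma resolvent_identity:
  assumes H: "H \<in> symm_mats N" and B: "B \<in> symm_mats N" and HB: "H + x \<cdot>\<^sub>m B \<in> symm_mats N"
    and z: "Im z > 0"
  shows "resolvent (H + x \<cdot>\<^sub>m B) z = resolvent H z + 
     of_real x \<cdot>\<^sub>m (resolvent H z * cmat B * resolvent (H + x \<cdot>\<^sub>m B) z)"
proof -
  let ?G = "resolvent H z" and ?G' = "resolvent (H + x \<cdot>\<^sub>m B) z"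
  note G = resolvent_inverse[OF H z] and G' = resolvent_inverse[OF HB z]
  have Bc: "cmat B \<in> carrier_mat N N" using symm_mats_carrier[OF B] by simp
  have M: "shift_mat H z \<in> carrier_mat N N" using symm_mats_carrier[OF H] by simp
  have M': "shift_mat (H + x \<cdot>\<^sub>m B) z \<in> carrier_mat N N" using symm_mats_carrier[OF HB] by simp
  have eq: "shift_mat H z = shift_mat (H + x \<cdot>\<^sub>m B) z + of_real x \<cdot>\<^sub>m cmat B"
    using symm_mats_carrier[OF H] symm_mats_carrier[OF B] by (auto simp: shift_mat_def intro!: eq_matI)
  have "?G' = (?G * shift_mat H z) * ?G'" using G G' by simp
  also have "\<dots> = ?G * (shift_mat (H + x \<cdot>\<^sub>m B) z * ?G') + ?G * (of_real x \<cdot>\<^sub>m cmat B * ?G')"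
    using G(1) G'(1) Bc M M' unfolding eq
    by (simp add: assoc_mult_mat[of _ N N _ N _ N] mult_add_distrib_mat[of _ N N _ N]
        add_mult_distrib_mat[of _ N N _ _ N])
  also have "\<dots> = ?G + of_real x \<cdot>\<^sub>m (?G * cmat B * ?G')"
    unfolding G'(2) using G(1) G'(1) Bc
    by (simp add: assoc_mult_mat[of _ N N _ N _ N] mult_smult_distrib[of _ N N _ N] mult_smult_assoc_mat[of _ N N _ N])
  finally show ?thesis .
qed

lemma mult_resolvent_expand:
  assumes H: "H \<in> symm_mats N" and B: "B \<in> symm_mats N" and HB: "H + x \<cdot>\<^sub>m B \<in> symm_mats N"
    and z: "Im z > 0" and X: "X \<in> carrier_mat N N"
  shows "matrix_trace (X * resolvent (H + x \<cdot>\<^sub>m B) z) = matrix_trace (X * resolvent H z) +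
     of_real x * matrix_trace (X * (resolvent H z * cmat B) * resolvent (H + x \<cdot>\<^sub>m B) z)"
proof -
  let ?G = "resolvent H z" and ?G' = "resolvent (H + x \<cdot>\<^sub>m B) z"
  note G = resolvent_inverse(1)[OF H z] and G' = resolvent_inverse(1)[OF HB z]
  have Bc: "cmat B \<in> carrier_mat N N" using symm_mats_carrier[OF B] by simp
  have "X * ?G' = X * (?G + of_real x \<cdot>\<^sub>m (?G * cmat B * ?G'))"
    using resolvent_identity[OF H B HB z] by simp
  also have "\<dots> = X * ?G + of_real x \<cdot>\<^sub>m (X * (?G * cmat B) * ?G')"
    using X G G' Bc
    by (simp add: assoc_mult_mat[of _ N N _ N _ N] mult_add_distrib_mat[of _ N N _ N]
        mult_smult_distrib[of _ N N _ N])
  also have "matrix_trace \<dots> = matrix_trace (X * ?G) +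
      of_real x * matrix_trace (X * (?G * cmat B) * ?G')"
  proof -
    have c1: "X * ?G \<in> carrier_mat N N" and c2: "X * (?G * cmat B) * ?G' \<in> carrier_mat N N"
      using X G G' Bc by auto
    show ?thesis
      using trace_add[OF c1 smult_carrier_mat[OF c2]] trace_smult[OF c2] by simp
  qed
  finally show ?thesis .
qed

text \<open>The resolvent identity iterated two and three times, an exact Taylor formula whose
  remainder still contains the perturbed resolvent. The second-order form is good for large
  \<open>x\<close>, the third-order form for small \<open>x\<close>.\<close>

lemma trace_resolvent_expand:
  assumes H: "H \<in> symm_mats N" and B: "B \<in> symm_mats N" and HB: "H + x \<cdot>\<^sub>m B \<in> symm_mats N"
    and z: "Im z > 0"
  defines "Y \<equiv> resolvent H z * cmat B"
  defines "Z \<equiv> Y * Y"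
  defines "W \<equiv> Z * Y"
  shows "matrix_trace (resolvent (H + x \<cdot>\<^sub>m B) z) = matrix_trace (resolvent H z) +
      of_real x * matrix_trace (Y * resolvent H z) +
      (of_real x)^2 * matrix_trace (Z * resolvent (H + x \<cdot>\<^sub>m B) z)" (is ?A)
    "matrix_trace (resolvent (H + x \<cdot>\<^sub>m B) z) = matrix_trace (resolvent H z) +
      of_real x * matrix_trace (Y * resolvent H z) +
      (of_real x)^2 * matrix_trace (Z * resolvent H z) +
      (of_real x)^3 * matrix_trace (W * resolvent (H + x \<cdot>\<^sub>m B) z)" (is ?B)
proof -
  note G = resolvent_inverse(1)[OF H z] and G' = resolvent_inverse(1)[OF HB z]
  have Y: "Y \<in> carrier_mat N N" using symm_mats_carrier[OF B] G by (auto simp: Y_def)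
  then have Z: "Z \<in> carrier_mat N N" and W: "W \<in> carrier_mat N N" by (auto simp: Z_def W_def)
  note E = mult_resolvent_expand[OF H B HB z]
  have 1: "matrix_trace (resolvent (H + x \<cdot>\<^sub>m B) z) = matrix_trace (resolvent H z) +
      of_real x * matrix_trace (Y * resolvent (H + x \<cdot>\<^sub>m B) z)"
    using E[OF one_carrier_mat] G G' Y by (simp add: Y_def[symmetric])
  have 2: "matrix_trace (Y * resolvent (H + x \<cdot>\<^sub>m B) z) = matrix_trace (Y * resolvent H z) +
      of_real x * matrix_trace (Z * resolvent (H + x \<cdot>\<^sub>m B) z)"
    using E[OF Y] by (simp add: Y_def[symmetric] Z_def[symmetric])
  have 3: "matrix_trace (Z * resolvent (H + x \<cdot>\<^sub>m B) z) = matrix_trace (Z * resolvent H z) +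
      of_real x * matrix_trace (W * resolvent (H + x \<cdot>\<^sub>m B) z)"
    using E[OF Z] by (simp add: Y_def[symmetric] W_def[symmetric])
  show ?A unfolding 1 2 by (simp add: algebra_simps power2_eq_square)
  show ?B unfolding 1 2 3 by (simp add: algebra_simps power2_eq_square power3_eq_cube)
qed

text \<open>One and the same quadratic polynomial has to serve both remainders. Against the
  second-order form the error is a difference of two traces of size \<open>b^2 / Im z ^ 3\<close>,
  hence the factor 2; against the third-order form it is one trace of size
  \<open>b^3 / Im z ^ 4\<close>. The minimum is integrable as soon as \<open>x^2\<close> is.\<close>

lemma trace_resolvent_quadratic_approx:
  assumes H: "H \<in> symm_mats N" and B: "B \<in> symm_mats N" and HB: "\<And>x. H + x \<cdot>\<^sub>m B \<in> symm_mats N"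
    and z: "Im z > 0" and b: "op_bound N (cmat B) b"
  obtains c0 c1 c2 :: real where
    "\<And>x. \<bar>Im (matrix_trace (resolvent (H + x \<cdot>\<^sub>m B) z)) - (c0 + c1 * x + c2 * x^2)\<bar>
      \<le> real N * (2 * b^2 / Im z ^ 3 + b^3 / Im z ^ 4) * min (x^2) (\<bar>x\<bar>^3)"
proof -
  define Y where "Y = resolvent H z * cmat B"
  define Z where "Z = Y * Y"
  define W where "W = Z * Y"
  let ?G = "resolvent H z" and ?G' = "\<lambda>x. resolvent (H + x \<cdot>\<^sub>m B) z"
  define c0 where "c0 = Im (matrix_trace ?G)"
  define c1 where "c1 = Im (matrix_trace (Y * ?G))"
  define c2 where "c2 = Im (matrix_trace (Z * ?G))"
  note E = trace_resolvent_expand[OF H B HB z, folded Y_def, folded Z_def, folded W_def]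
  have oG: "op_bound N ?G (1 / Im z)" by (rule op_bound_resolvent[OF H z])
  have oG': "op_bound N (?G' x) (1 / Im z)" for x by (rule op_bound_resolvent[OF HB z])
  have oY: "op_bound N Y (1 / Im z * b)" unfolding Y_def by (rule op_bound_mult[OF oG b])
  have oZ: "op_bound N Z (1 / Im z * b * (1 / Im z * b))" unfolding Z_def by (rule op_bound_mult[OF oY oY])
  have oW: "op_bound N W (1 / Im z * b * (1 / Im z * b) * (1 / Im z * b))"
    unfolding W_def by (rule op_bound_mult[OF oZ oY])
  have b0: "b \<ge> 0" using b by (simp add: op_bound_def)
  have tZ: "cmod (matrix_trace (Z * ?G)) \<le> real N * (b^2 / Im z ^ 3)"
    and tZ': "cmod (matrix_trace (Z * ?G' x)) \<le> real N * (b^2 / Im z ^ 3)"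
    and tW': "cmod (matrix_trace (W * ?G' x)) \<le> real N * (b^3 / Im z ^ 4)" for x
    using cmod_trace_le[OF op_bound_mult[OF oZ oG]] cmod_trace_le[OF op_bound_mult[OF oZ oG']]
      cmod_trace_le[OF op_bound_mult[OF oW oG']]
    by (simp_all add: power2_eq_square power3_eq_cube power4_eq_xxxx mult_ac)
  have "\<bar>Im (matrix_trace (?G' x)) - (c0 + c1 * x + c2 * x^2)\<bar>
      \<le> real N * (2 * b^2 / Im z ^ 3 + b^3 / Im z ^ 4) * min (x^2) (\<bar>x\<bar>^3)" for x
  proof -
    let ?C2 = "real N * (b^2 / Im z ^ 3)" and ?C3 = "real N * (b^3 / Im z ^ 4)"
    have C: "?C2 \<ge> 0" "?C3 \<ge> 0" using b0 z by auto
    have sq: "(complex_of_real x)^2 = of_real (x^2)" "(complex_of_real x)^3 = of_real (x^3)" by auto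
    have "\<bar>Im (matrix_trace (?G' x)) - (c0 + c1 * x + c2 * x^2)\<bar> =
        \<bar>x^2 * (Im (matrix_trace (Z * ?G' x)) - Im (matrix_trace (Z * ?G)))\<bar>"
      unfolding E(1)[of x] c0_def c1_def c2_def sq by (simp add: algebra_simps)
    also have "\<dots> \<le> x^2 * (2 * ?C2)"
      unfolding abs_mult
      using tZ tZ'[of x] abs_Im_le_cmod[of "matrix_trace (Z * ?G' x)"] abs_Im_le_cmod[of "matrix_trace (Z * ?G)"]
      by (intro mult_mono) auto
    also have "\<dots> \<le> (2 * ?C2 + ?C3) * x^2"
      using mult_right_mono[of "2 * ?C2" "2 * ?C2 + ?C3" "x^2"] C by (simp add: mult.commute)
    finally have 1: "\<bar>Im (matrix_trace (?G' x)) - (c0 + c1 * x + c2 * x^2)\<bar> \<le> (2 * ?C2 + ?C3) * x^2" .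
    have "\<bar>Im (matrix_trace (?G' x)) - (c0 + c1 * x + c2 * x^2)\<bar> =
        \<bar>x^3 * Im (matrix_trace (W * ?G' x))\<bar>"
      unfolding E(2)[of x] c0_def c1_def c2_def sq by (simp add: algebra_simps)
    also have "\<dots> \<le> \<bar>x\<bar>^3 * ?C3"
      unfolding abs_mult power_abs
      using tW'[of x] abs_Im_le_cmod[of "matrix_trace (W * ?G' x)"] by (intro mult_mono) auto
    also have "\<dots> \<le> (2 * ?C2 + ?C3) * \<bar>x\<bar>^3"
      using mult_right_mono[of "?C3" "2 * ?C2 + ?C3" "\<bar>x\<bar>^3"] C by (simp add: mult.commute)
    finally have 2: "\<bar>Im (matrix_trace (?G' x)) - (c0 + c1 * x + c2 * x^2)\<bar> \<le> (2 * ?C2 + ?C3) * \<bar>x\<bar>^3" .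
    have "2 * ?C2 + ?C3 = real N * (2 * b^2 / Im z ^ 3 + b^3 / Im z ^ 4)" by (simp add: algebra_simps)
    with 1 2 show ?thesis by (simp add: min_def)
  qed
  then show ?thesis using that by blast
qed

section \<open>Characteristic polynomial, eigenvalues and the Poisson integral of the
  spectrum\<close>

lemma poly_char_poly_shift_mat:
  assumes "H \<in> carrier_mat N N"
  shows "poly (char_poly (cmat H)) z = det (shift_mat H z)"
  unfolding char_poly_def using assms
  by (intro poly_det_cong[of _ N]) (auto simp: char_poly_matrix_def shift_mat_def)

text \<open>Jacobi's formula: the derivative is the sum of the characteristic polynomials of the
  principal minors, which are the diagonal cofactors.\<close>

lemma poly_pderiv_char_poly_shift_mat:
  assumes H: "H \<in> carrier_mat N N"
  shows "poly (pderiv (char_poly (cmat H))) z = matrix_trace (adj_mat (shift_mat H z))"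
proof -
  have "poly (char_poly (mat_delete (cmat H) i i)) z = det (mat_delete (shift_mat H z) i i)"
    if "i < N" for i
    unfolding char_poly_def using H that
    by (intro poly_det_cong[of _ "N - 1"]) (auto simp: char_poly_matrix_def shift_mat_def mat_delete_def)
  then show ?thesis
    using H pderiv_char_poly[of "cmat H" N]
    by (auto simp: poly_sum matrix_trace_def adj_mat_def cofactor_def shift_mat_def intro!: sum.cong)
qed

lemma poly_pderiv_prod_linear:
  assumes "poly (\<Prod>a\<leftarrow>as. [:- a, 1:]) z \<noteq> (0 :: complex)"
  shows "poly (pderiv (\<Prod>a\<leftarrow>as. [:- a, 1:])) z / poly (\<Prod>a\<leftarrow>as. [:- a, 1:]) z = (\<Sum>a\<leftarrow>as. 1 / (z - a))"
  using assms
proof (induction as)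
  case (Cons a as)
  let ?p = "\<Prod>a\<leftarrow>as. [:- a, 1:]"
  have nz: "z - a \<noteq> 0" "poly ?p z \<noteq> 0" using Cons.prems by auto
  have "poly (pderiv ([:- a, 1:] * ?p)) z = poly ?p z + (z - a) * poly (pderiv ?p) z"
    by (simp only: pderiv_mult poly_add poly_mult) (simp add: pderiv_pCons algebra_simps)
  moreover have "poly ([:- a, 1:] * ?p) z = (z - a) * poly ?p z"
    by (simp add: algebra_simps)
  ultimately have "poly (pderiv ([:- a, 1:] * ?p)) z / poly ([:- a, 1:] * ?p) z
      = 1 / (z - a) + poly (pderiv ?p) z / poly ?p z"
    using nz by (simp only: add_divide_distrib) simp
  then show ?case using Cons.IH[OF nz(2)]
    by (simp only: list.map prod_list.Cons sum_list.Cons)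
qed simp

text \<open>On an eigenvector the form of \<open>Im_shift_mat_form\<close> at \<open>z = a\<close>
  vanishes, while it equals \<open>Im a\<close> times a positive number.\<close>

lemma symm_mat_eigenvalue_real:
  assumes H: "H \<in> symm_mats N" and "eigenvalue (cmat H) a"
  shows "Im a = 0"
proof -
  have Hc: "cmat H \<in> carrier_mat N N" using symm_mats_carrier[OF H] by simp
  obtain v where v: "v \<in> carrier_vec N" "v \<noteq> 0\<^sub>v N" "cmat H *\<^sub>v v = a \<cdot>\<^sub>v v"
    using assms(2) Hc by (auto simp: eigenvalue_def eigenvector_def)
  have "(shift_mat H a *\<^sub>v v) $ i = 0" if "i < N" for i
  proof -
    have "(cmat H *\<^sub>v v) $ i = (\<Sum>j<N. of_real (H $$ (i,j)) * v $ j)"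
      using symm_mats_carrier[OF H] that by (subst index_mult_mat_vec_sum[OF Hc v(1)]) (auto intro!: sum.cong)
    then show ?thesis
      using that v by (subst shift_mat_mult_vec[OF symm_mats_carrier[OF H] v(1)]) auto
  qed
  then have "Im a * (vnorm v)^2 = 0"
    using Im_shift_mat_form[OF H v(1), of a] by simp
  then show ?thesis using v vnorm_eq_0D by auto
qed

text \<open>Instead of diagonalising, the characteristic polynomial is factored over the complex
  numbers. Its roots are real, so the factorisation descends to the real polynomial, whose root
  multiset therefore has full size. The trace is \<open>p' / p\<close> for the characteristic
  polynomial \<open>p\<close>, by Jacobi's formula.\<close>

lemma symm_mat_spectrum:
  assumes H: "H \<in> symm_mats N"
  obtains ls :: "real list" where "length ls = N" "eigenvalues_mset H = mset ls"
    "\<And>z. Im z > 0 \<Longrightarrow> matrix_trace (resolvent H z) = (\<Sum>x\<leftarrow>ls. 1 / (z - of_real x))"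
proof -
  note Hc' = symm_mats_carrier[OF H]
  have Hc: "cmat H \<in> carrier_mat N N" using Hc' by simp
  obtain as where as: "char_poly (cmat H) = (\<Prod>a\<leftarrow>as. [:- a, 1:])" "length as = N"
    using char_poly_factorized[OF Hc] by blast
  have real: "of_real (Re a) = a" if "a \<in> set as" for a
  proof -
    have "poly (char_poly (cmat H)) a = 0" using that unfolding as(1)
      by (induction as) auto
    then have "Im a = 0" using symm_mat_eigenvalue_real[OF H] eigenvalue_root_char_poly[OF Hc] by blast
    then show ?thesis by (simp add: complex_eq_iff)
  qed
  define ls where "ls = map Re as"
  have as_ls: "as = map of_real ls" unfolding ls_def using real by (simp add: map_idI)
  interpret mp: map_poly_inj_comm_ring_hom complex_of_real ..
  have "char_poly (cmat H) = map_poly complex_of_real (char_poly H)"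
    by (rule of_real_hom.char_poly_hom[OF Hc'])
  then have "map_poly complex_of_real (char_poly H) = map_poly of_real (\<Prod>a\<leftarrow>ls. [:- a, 1:])"
    using as(1) by (simp add: as_ls mp.hom_prod_list o_def hom_distribs)
  then have cp: "char_poly H = (\<Prod>a\<leftarrow>ls. [:- a, 1:])"
    by (simp only: mp.eq_iff)
  have "eigenvalues_mset H = mset ls"
  proof -
    have "(0 :: real poly) \<notin> set (map (\<lambda>a. [:- a, 1:]) ls)" by auto
    from proots_prod_list[OF this]
    have "proots (\<Prod>a\<leftarrow>ls. [:- a, 1:]) = (\<Sum>a\<leftarrow>ls. {#a#})" by (simp add: o_def)
    also have "\<dots> = mset ls" by (induction ls) auto
    finally show ?thesis unfolding eigenvalues_mset_def cp .
  qed
  moreover have "matrix_trace (resolvent H z) = (\<Sum>x\<leftarrow>ls. 1 / (z - of_real x))" if z: "Im z > 0" for z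
  proof -
    have d: "poly (\<Prod>a\<leftarrow>as. [:- a, 1:]) z = det (shift_mat H z)"
      using poly_char_poly_shift_mat[OF Hc', of z] as(1) by simp
    have "matrix_trace (resolvent H z) = matrix_trace (adj_mat (shift_mat H z)) / det (shift_mat H z)"
      unfolding resolvent_def using trace_smult[OF adj_mat(1)[OF shift_mat_carrier[OF Hc']]] by simp
    also have "\<dots> = (\<Sum>a\<leftarrow>as. 1 / (z - a))"
      using poly_pderiv_prod_linear[of as z] det_shift_mat_nonzero[OF H z] d
        poly_pderiv_char_poly_shift_mat[OF Hc', of z] as(1) by simp
    finally show ?thesis by (simp add: as_ls o_def)
  qed
  moreover have "length ls = N" using as(2) by (simp add: ls_def)
  ultimately show ?thesis by (rule that[rotated])
qed

lemma sum_list_map_eq_sum_count_mset: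
  fixes f :: "'a \<Rightarrow> real"
  assumes "finite A" "set xs \<subseteq> A"
  shows "(\<Sum>x\<leftarrow>xs. f x) = (\<Sum>x\<in>A. real (count (mset xs) x) * f x)"
  using assms(2)
proof (induction xs)
  case (Cons y xs)
  have "(\<Sum>x\<in>A. real (count (mset (y # xs)) x) * f x)
      = (\<Sum>x\<in>A. (if x = y then f x else 0) + real (count (mset xs) x) * f x)"
    by (intro sum.cong) (auto simp: algebra_simps)
  also have "\<dots> = f y + (\<Sum>x\<in>A. real (count (mset xs) x) * f x)"
    using assms(1) Cons.prems by (simp add: sum.distrib)
  finally show ?case using Cons by simp
qed simp

text \<open>\<open>- Im (1 / (z - x))\<close> is \<open>pi\<close> times the Poisson kernel at
  height \<open>Im z\<close>. This is the bridge from spectral measures to resolvents.\<close>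

lemma empirical_eigen_dist_integral:
  fixes H :: "real mat"
  assumes H: "H \<in> symm_mats N" and N: "N > 0" and z: "Im z > 0"
  shows "(\<integral>x. Im z / ((Re z - x)^2 + (Im z)^2) \<partial>empirical_eigen_dist H)
    = - Im (matrix_trace (resolvent H z)) / real N"
proof -
  obtain ls :: "real list" where ls: "length ls = N" "eigenvalues_mset H = mset ls"
    "matrix_trace (resolvent H z) = (\<Sum>x\<leftarrow>ls. 1 / (z - of_real x))"
    using symm_mat_spectrum[OF H] z by metis
  define f where "f = (\<lambda>x. Im z / ((Re z - x)^2 + (Im z)^2))"
  have ne: "mset ls \<noteq> {#}" using ls N by auto
  have [measurable]: "f \<in> borel_measurable borel" unfolding f_def by measurable
  have f: "- Im (1 / (z - of_real x)) = f x" for x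
    by (simp add: f_def Im_divide power2_eq_square)
  have "- Im (matrix_trace (resolvent H z)) = (\<Sum>x\<leftarrow>ls. f x)"
    unfolding ls(3) f[symmetric] by (induction ls) auto
  also have "\<dots> = (\<Sum>x\<in>set ls. real (count (mset ls) x) * f x)"
    by (intro sum_list_map_eq_sum_count_mset) auto
  finally have 1: "- Im (matrix_trace (resolvent H z)) = (\<Sum>x\<in>set ls. real (count (mset ls) x) * f x)" .
  have "(\<integral>x. f x \<partial>empirical_eigen_dist H) = (\<integral>x. f x \<partial>measure_pmf (pmf_of_multiset (mset ls)))"
    unfolding empirical_eigen_dist_def ls(2) by (simp add: integral_distr)
  also have "\<dots> = (\<Sum>x\<in>set ls. f x * pmf (pmf_of_multiset (mset ls)) x)"
    using ne by (subst integral_measure_pmf[of "set ls"]) (auto simp: mult_ac)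
  also have "\<dots> = (\<Sum>x\<in>set ls. real (count (mset ls) x) * f x) / real N"
    using ne ls(1) by (simp add: sum_divide_distrib mult_ac)
  finally show ?thesis unfolding f_def[symmetric] 1 .
qed

lemma real_distribution_empirical:
  "real_distribution (empirical_eigen_dist H)"
  unfolding empirical_eigen_dist_def real_distribution_def real_distribution_axioms_def
  by (auto intro!: measure_pmf.prob_space_distr)

subsection \<open>Averaging over rank two perturbations\<close>

text \<open>With \<open>w\<close> the resolvent applied to \<open>cc\<close>, one has
  \<open>cc = (z - H) w\<close>, so the form is the conjugate of the one in
  \<open>Im_shift_mat_form\<close>. Reality of \<open>c\<close> lets the bilinear product replace
  the Hermitian one.\<close>

lemma real_form_resolvent_nonneg:
  fixes c :: "real vec"
  assumes H: "H \<in> symm_mats N" and z: "Im z > 0" and c: "c \<in> carrier_vec N"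
  defines "cc \<equiv> map_vec complex_of_real c"
  shows "Im (cc \<bullet> (resolvent H z *\<^sub>v cc)) \<le> 0"
proof -
  define w where "w = resolvent H z *\<^sub>v cc"
  have cc: "cc \<in> carrier_vec N" using c by (auto simp: cc_def)
  have w: "w \<in> carrier_vec N" using resolvent_inverse(1)[OF H z] cc by (auto simp: w_def)
  have "cnj (cc \<bullet> w) = (\<Sum>i<N. cnj (w $ i) * cc $ i)"
    using w c by (auto simp: scalar_prod_def cc_def lessThan_atLeast0 mult.commute intro!: sum.cong)
  then have "Im (cnj (cc \<bullet> w)) = Im z * (vnorm w)^2"
    using Im_shift_mat_form[OF H w, of z] shift_mat_resolvent_vec[OF H z cc] by (simp add: w_def)
  moreover have "Im z * (vnorm w)^2 \<ge> 0" using z by simp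
  ultimately show ?thesis by (simp add: w_def)
qed

text \<open>
  Writing \<open>W\<close> for the matrix of the Greek letters and \<open>P\<close> for that of the Latin ones, the
  hypotheses say \<open>(1 - t W) P = W\<close> and \<open>D = det (1 - t W)\<close>. The first conclusion,
  \<open>det (1 - t W) det (1 + t P) = 1\<close>, shows that \<open>D\<close> never vanishes; the second says that the
  trace of \<open>P\<close> is the logarithmic derivative \<open>- D' / D\<close>.
\<close>

lemma two_by_two_woodbury:
  fixes \<alpha> \<beta> \<beta>' \<zeta> p q p' q' t :: complex
  assumes "p = \<alpha> + t * (\<alpha> * p + \<beta> * q)" "q = \<beta>' + t * (\<beta>' * p + \<zeta> * q)"
    "p' = \<beta> + t * (\<alpha> * p' + \<beta> * q')" "q' = \<zeta> + t * (\<beta>' * p' + \<zeta> * q')"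
  defines "D \<equiv> 1 - t * (\<alpha> + \<zeta>) + t^2 * (\<alpha> * \<zeta> - \<beta> * \<beta>')"
  shows "D * (1 + t * (p + q') + t^2 * (p * q' - p' * q)) = 1"
    "D * (p + q') = (\<alpha> + \<zeta>) - 2 * t * (\<alpha> * \<zeta> - \<beta> * \<beta>')"
proof -
  have e: "(1 - t*\<alpha>) * p - t*\<beta>*q = \<alpha>" "(1 - t*\<zeta>) * q - t*\<beta>'*p = \<beta>'"
    "(1 - t*\<alpha>) * p' - t*\<beta>*q' = \<beta>" "(1 - t*\<zeta>) * q' - t*\<beta>'*p' = \<zeta>"
    using assms(1-4) by (auto simp: algebra_simps)
  have D: "D = (1 - t*\<alpha>) * (1 - t*\<zeta>) - t^2*\<beta>*\<beta>'"
    by (simp add: D_def algebra_simps power2_eq_square)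
  \<comment> \<open>Cramer's rule: each unknown is isolated by combining its two equations with
    cofactors of \<open>1 - t W\<close>.\<close>
  have "D * p = (1 - t*\<zeta>) * ((1 - t*\<alpha>) * p - t*\<beta>*q) + t*\<beta> * ((1 - t*\<zeta>) * q - t*\<beta>'*p)"
    unfolding D by (simp add: algebra_simps power2_eq_square)
  then have Dp: "D * p = (1 - t*\<zeta>) * \<alpha> + t*\<beta>*\<beta>'" unfolding e by simp
  have "D * q = (1 - t*\<alpha>) * ((1 - t*\<zeta>) * q - t*\<beta>'*p) + t*\<beta>' * ((1 - t*\<alpha>) * p - t*\<beta>*q)"
    unfolding D by (simp add: algebra_simps power2_eq_square)
  then have Dq: "D * q = (1 - t*\<alpha>) * \<beta>' + t*\<beta>'*\<alpha>" unfolding e by simp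
  have "D * p' = (1 - t*\<zeta>) * ((1 - t*\<alpha>) * p' - t*\<beta>*q') + t*\<beta> * ((1 - t*\<zeta>) * q' - t*\<beta>'*p')"
    unfolding D by (simp add: algebra_simps power2_eq_square)
  then have Dp': "D * p' = (1 - t*\<zeta>) * \<beta> + t*\<beta>*\<zeta>" unfolding e by simp
  have "D * q' = (1 - t*\<alpha>) * ((1 - t*\<zeta>) * q' - t*\<beta>'*p') + t*\<beta>' * ((1 - t*\<alpha>) * p' - t*\<beta>*q')"
    unfolding D by (simp add: algebra_simps power2_eq_square)
  then have Dq': "D * q' = (1 - t*\<alpha>) * \<zeta> + t*\<beta>'*\<beta>" unfolding e by simp
  show "D * (p + q') = (\<alpha> + \<zeta>) - 2 * t * (\<alpha> * \<zeta> - \<beta> * \<beta>')"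
    unfolding distrib_left Dp Dq' by (simp add: algebra_simps)
  \<comment> \<open>The four entries of \<open>(1 - t W) (1 + t P) = 1\<close>.\<close>
  have a: "(1 - t*\<alpha>) * (1 + t * p) - t*\<beta>*(t*q) = 1" "(1 - t*\<zeta>) * (t * q) - t*\<beta>'*(1 + t * p) = 0"
    "(1 - t*\<alpha>) * (t * p') - t*\<beta>*(1 + t*q') = 0" "(1 - t*\<zeta>) * (1 + t * q') - t*\<beta>'*(t*p') = 1"
  proof -
    have "(1 - t*\<alpha>) * (1 + t * p) - t*\<beta>*(t*q) = 1 - t*\<alpha> + t * ((1 - t*\<alpha>) * p - t*\<beta>*q)"
      "(1 - t*\<zeta>) * (t * q) - t*\<beta>'*(1 + t * p) = t * ((1 - t*\<zeta>) * q - t*\<beta>'*p) - t*\<beta>'"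
      "(1 - t*\<alpha>) * (t * p') - t*\<beta>*(1 + t*q') = t * ((1 - t*\<alpha>) * p' - t*\<beta>*q') - t*\<beta>"
      "(1 - t*\<zeta>) * (1 + t * q') - t*\<beta>'*(t*p') = 1 - t*\<zeta> + t * ((1 - t*\<zeta>) * q' - t*\<beta>'*p')"
      by (simp_all add: algebra_simps)
    then show "(1 - t*\<alpha>) * (1 + t * p) - t*\<beta>*(t*q) = 1" "(1 - t*\<zeta>) * (t * q) - t*\<beta>'*(1 + t * p) = 0"
      "(1 - t*\<alpha>) * (t * p') - t*\<beta>*(1 + t*q') = 0" "(1 - t*\<zeta>) * (1 + t * q') - t*\<beta>'*(t*p') = 1"
      unfolding e by simp_all
  qed
  have "D * ((1 + t * p) * (1 + t * q') - (t * p') * (t * q)) =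
      ((1 - t*\<alpha>) * (1 + t * p) - t*\<beta>*(t*q)) * ((1 - t*\<zeta>) * (1 + t * q') - t*\<beta>'*(t*p'))
      - ((1 - t*\<zeta>) * (t * q) - t*\<beta>'*(1 + t * p)) * ((1 - t*\<alpha>) * (t * p') - t*\<beta>*(1 + t*q'))"
  proof -
    \<comment> \<open>Multiplicativity of the 2 by 2 determinant.\<close>
    have *: "(A*Z - b*b') * (X*Y' - X'*Y) = (A*X - b*Y) * (Z*Y' - b'*X') - (Z*Y - b'*X) * (A*X' - b*Y')"
      for A Z b b' X Y X' Y' :: complex
      by (simp add: algebra_simps)
    have D': "D = (1 - t*\<alpha>) * (1 - t*\<zeta>) - (t*\<beta>) * (t*\<beta>')"
      unfolding D by (simp add: power2_eq_square)
    show ?thesis unfolding D' by (rule *)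
  qed
  then have "D * ((1 + t * p) * (1 + t * q') - (t * p') * (t * q)) = 1"
    unfolding a by simp
  then show "D * (1 + t * (p + q') + t^2 * (p * q' - p' * q)) = 1"
    by (simp add: algebra_simps power2_eq_square)
qed

lemma complex_quadratic_roots:
  fixes w \<delta> :: complex
  obtains a b where "a + b = w" "a * b = \<delta>"
proof -
  define r where "r = csqrt (w^2 - 4 * \<delta>)"
  have r: "r * r = w^2 - 4 * \<delta>" unfolding r_def by (metis power2_csqrt power2_eq_square)
  have "(w + r) / 2 + (w - r) / 2 = w" by (simp add: field_simps)
  moreover have "((w + r) / 2) * ((w - r) / 2) = \<delta>"
    using r by (simp add: field_simps power2_eq_square)
  ultimately show ?thesis using that by blast
qed

text \<open>Completing the square in \<open>t\<close> turns the integrand into a Cauchy kernel with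
  an arctangent as antiderivative, and any increment of the arctangent is below \<open>pi\<close>,
  whatever \<open>a\<close> is. For real \<open>a\<close> the integrand is zero, even at the pole,
  as division by zero gives zero.\<close>

lemma cauchy_kernel_integral_le_pi:
  fixes a :: complex
  shows "(\<integral>\<^sup>+t. ennreal (\<bar>Im a\<bar> / (cmod (1 - of_real t * a))^2) * indicator {-1..1} t \<partial>lborel) \<le> ennreal pi"
proof (cases "Im a = 0")
  case False
  define p q where "p = Re a" and "q = Im a"
  define r where "r = \<bar>q\<bar>"
  define F where "F = (\<lambda>t. arctan (((p^2 + q^2) * t - p) / r))"
  have r: "r > 0" and q2: "q^2 > 0" and r2: "r^2 = q^2" using False by (auto simp: q_def r_def)
  have n: "(cmod (1 - of_real t * a))^2 = (1 - t * p)^2 + (t * q)^2" for t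
    by (simp add: cmod_power2 p_def q_def)
  have key: "(p^2 + q^2) * ((1 - t * p)^2 + (t * q)^2) = ((p^2 + q^2) * t - p)^2 + q^2" for t
    by (simp add: algebra_simps power2_eq_square)
  have npos: "(1 - t * p)^2 + (t * q)^2 > 0" for t
  proof -
    have "(p^2 + q^2) * ((1 - t * p)^2 + (t * q)^2) > 0"
      unfolding key using q2 by (simp add: add_nonneg_pos)
    then show ?thesis using q2
      by (smt (verit) mult_nonneg_nonpos zero_le_power2)
  qed
  have "(F has_real_derivative (r / ((1 - t * p)^2 + (t * q)^2))) (at t)" for t
  proof -
    have *: "inverse (n * d / r^2) * (n / r) = r / d" if "n > 0" "d > 0" for n d :: real
      using that r by (simp add: field_simps power2_eq_square)
    have "1 + (((p^2 + q^2) * t - p) / r)^2 = (((p^2 + q^2) * t - p)^2 + r^2) / r^2"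
      using r by (simp add: add_divide_distrib power_divide)
    also have "\<dots> = (p^2 + q^2) * ((1 - t * p)^2 + (t * q)^2) / r^2"
      unfolding key r2 ..
    finally have "inverse (1 + (((p^2 + q^2) * t - p) / r)^2) * ((p^2 + q^2) / r)
        = r / ((1 - t * p)^2 + (t * q)^2)"
      using *[OF add_nonneg_pos[OF zero_le_power2[of p] q2] npos[of t]] by simp
    moreover have "(F has_real_derivative (inverse (1 + (((p^2 + q^2) * t - p) / r)^2) * ((p^2 + q^2) / r))) (at t)"
      unfolding F_def using r by (auto intro!: derivative_eq_intros simp del: power_divide)
    ultimately show ?thesis by simp
  qed
  then have "(\<integral>\<^sup>+t. ennreal (r / ((1 - t * p)^2 + (t * q)^2)) * indicator {-1..1} t \<partial>lborel)
      = ennreal (F 1 - F (-1))"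
    using npos r by (intro nn_integral_FTC_Icc) (auto intro!: DERIV_subset divide_nonneg_nonneg)
  also have "\<dots> \<le> ennreal pi"
    unfolding F_def using arctan_bounded[of "((p^2 + q^2) * 1 - p) / r"] arctan_bounded[of "((p^2 + q^2) * (-1) - p) / r"]
    by (intro ennreal_leI) auto
  finally show ?thesis unfolding n r_def q_def .
qed simp


text \<open>For \<open>v = c + i s\<close> this is the real part of \<open>v\<close> times its
  conjugate transpose, a real matrix of rank at most two.\<close>

definition plane_mat :: "nat \<Rightarrow> real vec \<Rightarrow> real vec \<Rightarrow> real mat" where
  "plane_mat N c s = mat N N (\<lambda>(i,j). c $ i * c $ j + s $ i * s $ j)"

lemma plane_mat_symm [simp]: "plane_mat N c s \<in> symm_mats N"
  by (rule symm_matsI) (auto simp: plane_mat_def mult.commute)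

lemma plane_mat_mult_vec:
  assumes c: "c \<in> carrier_vec N" "s \<in> carrier_vec N" and v: "v \<in> carrier_vec N"
  shows "cmat (plane_mat N c s) *\<^sub>v v = (map_vec complex_of_real c \<bullet> v) \<cdot>\<^sub>v map_vec complex_of_real c
     + (map_vec complex_of_real s \<bullet> v) \<cdot>\<^sub>v map_vec complex_of_real s"
  using c v
  by (intro eq_vecI) (auto simp: scalar_prod_def plane_mat_def sum_distrib_left sum_distrib_right
      algebra_simps sum.distrib intro!: sum.cong)

text \<open>This is \<open>- Im\<close> of the trace of \<open>plane_mat\<close> times the
  resolvent, written as two quadratic forms so that its sign can be read off.\<close>

definition plane_energy :: "real mat \<Rightarrow> complex \<Rightarrow> real vec \<Rightarrow> real vec \<Rightarrow> real" where
  "plane_energy H z c s = - Im (map_vec complex_of_real c \<bullet> (resolvent H z *\<^sub>v map_vec complex_of_real c)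
     + map_vec complex_of_real s \<bullet> (resolvent H z *\<^sub>v map_vec complex_of_real s))"

lemma plane_energy_nonneg:
  assumes "H \<in> symm_mats N" "Im z > 0" "c \<in> carrier_vec N" "s \<in> carrier_vec N"
  shows "plane_energy H z c s \<ge> 0"
  using real_form_resolvent_nonneg[OF assms(1,2,3)] real_form_resolvent_nonneg[OF assms(1,2,4)]
  by (simp add: plane_energy_def)

lemma symm_mats_add_smult:
  "H \<in> symm_mats N \<Longrightarrow> K \<in> symm_mats N \<Longrightarrow> H + x \<cdot>\<^sub>m K \<in> symm_mats N"
  using symm_mats_index[of H N] symm_mats_index[of K N] symm_mats_carrier[of H N] symm_mats_carrier[of K N]
  by (intro symm_matsI) auto

lemma smult_mat_mult_vec:
  fixes A :: "'a :: comm_ring_1 mat"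
  assumes "A \<in> carrier_mat m n" "v \<in> carrier_vec n"
  shows "(k \<cdot>\<^sub>m A) *\<^sub>v v = k \<cdot>\<^sub>v (A *\<^sub>v v)"
  using assms by (intro eq_vecI) auto

text \<open>For \<open>x\<close> and \<open>y\<close> ranging over \<open>C\<close> and
  \<open>S\<close> these identities close up: they are exactly the four hypotheses of
  \<open>two_by_two_woodbury\<close>, and the \<open>N\<close> by \<open>N\<close> problem becomes a
  2 by 2 one.\<close>

lemma plane_form_identity:
  fixes t :: real
  assumes H: "H \<in> symm_mats N" and z: "Im z > 0" and c: "c \<in> carrier_vec N" "s \<in> carrier_vec N"
    and x: "x \<in> carrier_vec N" and y: "y \<in> carrier_vec N"
  defines "C \<equiv> map_vec complex_of_real c" and "S \<equiv> map_vec complex_of_real s"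
  defines "G \<equiv> resolvent H z" and "G' \<equiv> resolvent (H + t \<cdot>\<^sub>m plane_mat N c s) z"
  shows "y \<bullet> (G' *\<^sub>v x) = y \<bullet> (G *\<^sub>v x) +
     of_real t * (y \<bullet> (G *\<^sub>v C) * (C \<bullet> (G' *\<^sub>v x)) + y \<bullet> (G *\<^sub>v S) * (S \<bullet> (G' *\<^sub>v x)))"
proof -
  let ?K = "plane_mat N c s"
  have HK: "H + t \<cdot>\<^sub>m ?K \<in> symm_mats N" using H by (intro symm_mats_add_smult) auto
  have G: "G \<in> carrier_mat N N" and G': "G' \<in> carrier_mat N N"
    unfolding G_def G'_def by (rule resolvent_inverse(1)[OF H z] resolvent_inverse(1)[OF HK z])+
  have Kc: "cmat ?K \<in> carrier_mat N N" using symm_mats_carrier[OF plane_mat_symm] by simp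
  have C: "C \<in> carrier_vec N" and S: "S \<in> carrier_vec N" using c by (auto simp: C_def S_def)
  have G'x: "G' *\<^sub>v x \<in> carrier_vec N" using G' x by auto
  have "G' *\<^sub>v x = (G + of_real t \<cdot>\<^sub>m (G * cmat ?K * G')) *\<^sub>v x"
    using resolvent_identity[OF H plane_mat_symm HK z] by (simp add: G_def G'_def)
  also have "\<dots> = G *\<^sub>v x + of_real t \<cdot>\<^sub>v (G *\<^sub>v (cmat ?K *\<^sub>v (G' *\<^sub>v x)))"
    using G G' Kc x by (simp add: add_mult_distrib_mat_vec[of _ N N] assoc_mult_mat_vec[of _ N N _ N] smult_mat_mult_vec[of _ N N])
  also have "cmat ?K *\<^sub>v (G' *\<^sub>v x) = (C \<bullet> (G' *\<^sub>v x)) \<cdot>\<^sub>v C + (S \<bullet> (G' *\<^sub>v x)) \<cdot>\<^sub>v S"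
    unfolding C_def S_def by (rule plane_mat_mult_vec[OF c G'x])
  also have "G *\<^sub>v \<dots> = (C \<bullet> (G' *\<^sub>v x)) \<cdot>\<^sub>v (G *\<^sub>v C) + (S \<bullet> (G' *\<^sub>v x)) \<cdot>\<^sub>v (G *\<^sub>v S)"
    using G C S by (simp add: mult_add_distrib_mat_vec[of _ N N] mult_mat_vec[of _ N N])
  finally have "G' *\<^sub>v x = G *\<^sub>v x + of_real t \<cdot>\<^sub>v
      ((C \<bullet> (G' *\<^sub>v x)) \<cdot>\<^sub>v (G *\<^sub>v C) + (S \<bullet> (G' *\<^sub>v x)) \<cdot>\<^sub>v (G *\<^sub>v S))" .
  then have "y \<bullet> (G' *\<^sub>v x) = y \<bullet> (G *\<^sub>v x + of_real t \<cdot>\<^sub>v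
      ((C \<bullet> (G' *\<^sub>v x)) \<cdot>\<^sub>v (G *\<^sub>v C) + (S \<bullet> (G' *\<^sub>v x)) \<cdot>\<^sub>v (G *\<^sub>v S)))"
    by simp
  also have "\<dots> = y \<bullet> (G *\<^sub>v x) + of_real t * (y \<bullet> (G *\<^sub>v C) * (C \<bullet> (G' *\<^sub>v x)) + y \<bullet> (G *\<^sub>v S) * (S \<bullet> (G' *\<^sub>v x)))"
  proof -
    have v: "G *\<^sub>v x \<in> carrier_vec N" "G *\<^sub>v C \<in> carrier_vec N" "G *\<^sub>v S \<in> carrier_vec N"
      using G x C S by auto
    show ?thesis using v y
      by (simp add: scalar_prod_add_distrib[of _ N] mult.commute)
  qed
  finally show ?thesis .
qed

text \<open>The determinant \<open>D\<close> factors as \<open>(1 - t a) (1 - t b)\<close>, with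
  \<open>a\<close> and \<open>b\<close> the eigenvalues of the unperturbed 2 by 2 matrix. The trace
  of the perturbed one is \<open>- D' / D\<close>, a sum of two partial fractions, and each
  imaginary part is a Cauchy kernel in \<open>t\<close> with integral at most \<open>pi\<close>.
  Nothing depends on \<open>H\<close>, \<open>z\<close> or the vectors.\<close>

lemma spectral_averaging:
  assumes H: "H \<in> symm_mats N" and z: "Im z > 0" and c: "c \<in> carrier_vec N" "s \<in> carrier_vec N"
  shows "(\<integral>\<^sup>+t. ennreal (plane_energy (H + t \<cdot>\<^sub>m plane_mat N c s) z c s) * indicator {-1..1} t \<partial>lborel)
    \<le> ennreal (2 * pi)"
proof -
  define C S where "C = map_vec complex_of_real c" and "S = map_vec complex_of_real s"
  define G where "G = resolvent H z"
  define G' where "G' = (\<lambda>t. resolvent (H + t \<cdot>\<^sub>m plane_mat N c s) z)"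
  define w where "w = C \<bullet> (G *\<^sub>v C) + S \<bullet> (G *\<^sub>v S)"
  define \<delta> where "\<delta> = (C \<bullet> (G *\<^sub>v C)) * (S \<bullet> (G *\<^sub>v S)) - (C \<bullet> (G *\<^sub>v S)) * (S \<bullet> (G *\<^sub>v C))"
  have CS: "C \<in> carrier_vec N" "S \<in> carrier_vec N" using c by (auto simp: C_def S_def)
  note I = plane_form_identity[OF H z c, folded C_def S_def, folded G_def]
  obtain a b where ab: "a + b = w" "a * b = \<delta>" using complex_quadratic_roots by blast
  let ?k = "\<lambda>a t. \<bar>Im a\<bar> / (cmod (1 - of_real t * a))^2"
  have bound: "plane_energy (H + t \<cdot>\<^sub>m plane_mat N c s) z c s \<le> ?k a t + ?k b t" for t
  proof -
    let ?p = "C \<bullet> (G' t *\<^sub>v C)" and ?q = "S \<bullet> (G' t *\<^sub>v C)" 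
    let ?p' = "C \<bullet> (G' t *\<^sub>v S)" and ?q' = "S \<bullet> (G' t *\<^sub>v S)"
    define D where "D = 1 - of_real t * w + (of_real t)^2 * \<delta>"
    note W = two_by_two_woodbury[OF I[OF CS(1) CS(1), of t, folded fun_cong[OF G'_def, symmetric]]
      I[OF CS(1) CS(2), of t] I[OF CS(2) CS(1), of t] I[OF CS(2) CS(2), of t]]
    have 1: "D * (1 + of_real t * (?p + ?q') + (of_real t)^2 * (?p * ?q' - ?p' * ?q)) = 1"
      and 2: "D * (?p + ?q') = w - 2 * of_real t * \<delta>"
      using W unfolding G'_def D_def w_def \<delta>_def by simp_all
    have D: "D = (1 - of_real t * a) * (1 - of_real t * b)"
      unfolding D_def ab[symmetric] by (simp add: algebra_simps power2_eq_square)
    \<comment> \<open>By the first Woodbury identity \<open>D\<close> has a multiplicative inverse,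
      so neither factor vanishes.\<close>
    have nz: "1 - of_real t * a \<noteq> 0" "1 - of_real t * b \<noteq> 0" using 1 D by auto
    have "w - 2 * of_real t * \<delta> = a * (1 - of_real t * b) + b * (1 - of_real t * a)"
      unfolding ab[symmetric] by (simp add: algebra_simps)
    moreover have "P = e / u + f / v" if "u * v * P = e * v + f * u" "u \<noteq> 0" "v \<noteq> 0" for u v P e f :: complex
      using that by (simp add: add_frac_eq eq_divide_eq mult_ac)
    ultimately have pq: "?p + ?q' = a / (1 - of_real t * a) + b / (1 - of_real t * b)"
      using 2 nz unfolding D by metis
    have im: "Im (u / (1 - of_real t * u)) = Im u / (cmod (1 - of_real t * u))^2" for u
      by (simp add: Im_divide cmod_power2 algebra_simps)
    have "plane_energy (H + t \<cdot>\<^sub>m plane_mat N c s) z c s = - Im (?p + ?q')"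
      by (simp add: plane_energy_def C_def S_def G'_def)
    also have "\<dots> = - Im a / (cmod (1 - of_real t * a))^2 - Im b / (cmod (1 - of_real t * b))^2"
      unfolding pq plus_complex.sel im by simp
    \<comment> \<open>Absolute values make it unnecessary to know the signs of \<open>Im a\<close>
      and \<open>Im b\<close>.\<close>
    also have "\<dots> \<le> ?k a t + ?k b t"
    proof -
      have "- Im u / (cmod (1 - of_real t * u))^2 \<le> ?k u t" for u
        by (intro divide_right_mono) auto
      from this[of a] this[of b] show ?thesis by simp
    qed
    finally show ?thesis .
  qed
  have "(\<integral>\<^sup>+t. ennreal (plane_energy (H + t \<cdot>\<^sub>m plane_mat N c s) z c s) * indicator {-1..1} t \<partial>lborel)
    \<le> (\<integral>\<^sup>+t. ennreal (?k a t) * indicator {-1..1} t + ennreal (?k b t) * indicator {-1..1} t \<partial>lborel)"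
    using bound by (intro nn_integral_mono) (auto simp: indicator_def ennreal_plus[symmetric] simp del: ennreal_plus intro!: ennreal_leI)
  also have "\<dots> = (\<integral>\<^sup>+t. ennreal (?k a t) * indicator {-1..1} t \<partial>lborel) +
      (\<integral>\<^sup>+t. ennreal (?k b t) * indicator {-1..1} t \<partial>lborel)"
    by (intro nn_integral_add) auto
  also have "\<dots> \<le> ennreal pi + ennreal pi"
    by (intro add_mono cauchy_kernel_integral_le_pi)
  also have "\<dots> = ennreal (2 * pi)" by (simp add: ennreal_plus[symmetric] del: ennreal_plus)
  finally show ?thesis .
qed

subsection \<open>Toeplitz matrices\<close>

lemma symm_mats_smult: "H \<in> symm_mats N \<Longrightarrow> x \<cdot>\<^sub>m H \<in> symm_mats N"
  using symm_mats_index[of H N] symm_mats_carrier[of H N] by (intro symm_matsI) auto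

lemma toeplitz_mat_symm: "toeplitz_mat a n \<in> symm_mats (n + 1)"
  by (rule symm_matsI) (auto simp: toeplitz_mat_def)

lemma toeplitz_mat_fun_upd:
  "c \<cdot>\<^sub>m toeplitz_mat (a(k := x)) n =
     c \<cdot>\<^sub>m toeplitz_mat (a(k := 0)) n + (c * x) \<cdot>\<^sub>m toeplitz_mat (\<lambda>i. if i = k then 1 else 0) n"
  by (rule eq_matI) (auto simp: toeplitz_mat_def)

text \<open>Split each entry as a product of square roots and apply Cauchy-Schwarz row by row; by
  symmetry the column sums that appear after exchanging the sums have the same bound.\<close>

lemma schur_test:
  assumes B: "B \<in> symm_mats N" and nn: "\<And>i j. i < N \<Longrightarrow> j < N \<Longrightarrow> 0 \<le> B $$ (i,j)"
    and row: "\<And>i. i < N \<Longrightarrow> (\<Sum>j<N. B $$ (i,j)) \<le> r" and r: "0 \<le> r"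
  shows "op_bound N (cmat B) r"
proof -
  have Bc: "cmat B \<in> carrier_mat N N" using symm_mats_carrier[OF B] by simp
  have "vnorm (cmat B *\<^sub>v v) \<le> r * vnorm v" if v: "v \<in> carrier_vec N" for v
  proof -
    have "(cmod ((cmat B *\<^sub>v v) $ i))^2 \<le> r * (\<Sum>j<N. B $$ (i,j) * (cmod (v $ j))^2)" if i: "i < N" for i
    proof -
      have "cmod ((cmat B *\<^sub>v v) $ i) \<le> (\<Sum>j<N. sqrt (B $$ (i,j)) * (sqrt (B $$ (i,j)) * cmod (v $ j)))"
        unfolding index_mult_mat_vec_sum[OF Bc v i]
        using nn[OF i] i symm_mats_carrier[OF B]
        by (intro order_trans[OF norm_sum] sum_mono) (auto simp: norm_mult mult.assoc[symmetric])
      then have "(cmod ((cmat B *\<^sub>v v) $ i))^2 \<le> (\<Sum>j<N. sqrt (B $$ (i,j)) * (sqrt (B $$ (i,j)) * cmod (v $ j)))^2"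
        by (intro power_mono) auto
      also have "\<dots> \<le> (\<Sum>j<N. (sqrt (B $$ (i,j)))^2) * (\<Sum>j<N. (sqrt (B $$ (i,j)) * cmod (v $ j))^2)"
        by (rule Cauchy_Schwarz_ineq_sum)
      also have "\<dots> = (\<Sum>j<N. B $$ (i,j)) * (\<Sum>j<N. B $$ (i,j) * (cmod (v $ j))^2)"
        using nn[OF i] by (intro arg_cong2[where f = "(*)"] sum.cong) (auto simp: power_mult_distrib)
      also have "\<dots> \<le> r * (\<Sum>j<N. B $$ (i,j) * (cmod (v $ j))^2)"
        using nn[OF i] by (intro mult_right_mono row[OF i] sum_nonneg) auto
      finally show ?thesis .
    qed
    then have "(vnorm (cmat B *\<^sub>v v))^2 \<le> (\<Sum>i<N. r * (\<Sum>j<N. B $$ (i,j) * (cmod (v $ j))^2))"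
      unfolding vnorm_square[OF mult_mat_vec_carrier[OF Bc v]] by (intro sum_mono) auto
    also have "\<dots> = r * (\<Sum>j<N. (\<Sum>i<N. B $$ (i,j)) * (cmod (v $ j))^2)"
      by (subst sum_distrib_left[symmetric], subst sum.swap) (simp add: sum_distrib_right)
    also have "\<dots> \<le> r * (\<Sum>j<N. r * (cmod (v $ j))^2)"
    proof (intro mult_left_mono[OF _ r] sum_mono mult_right_mono)
      fix j assume j: "j \<in> {..<N}"
      then have "(\<Sum>i<N. B $$ (i,j)) = (\<Sum>i<N. B $$ (j,i))"
        using symm_mats_index[OF B] by (intro sum.cong) auto
      then show "(\<Sum>i<N. B $$ (i,j)) \<le> r" using row[of j] j by simp
    qed auto
    also have "\<dots> = (r * vnorm v)^2"
      by (simp only: power_mult_distrib vnorm_square[OF v] sum_distrib_left[symmetric] power2_eq_square[of r] mult.assoc)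
    finally show ?thesis by (rule power2_le_imp_le) (simp add: r)
  qed
  then show ?thesis using Bc r by (auto simp: op_bound_def)
qed

lemma op_bound_toeplitz_unit:
  "op_bound (n + 1) (cmat (toeplitz_mat (\<lambda>i. if i = k then 1 else 0) n)) 2"
proof (rule schur_test[OF toeplitz_mat_symm])
  fix i assume i: "i < n + 1"
  have "(\<Sum>j<n+1. toeplitz_mat (\<lambda>i. if i = k then 1 else 0) n $$ (i,j))
      \<le> (\<Sum>j<n+1. (if j = i + k then 1 else 0) + (if j = i - k then 1 else 0) :: real)"
    using i by (intro sum_mono) (auto simp: toeplitz_mat_def)
  also have "\<dots> \<le> 2" by (simp add: sum.distrib)
  finally show "(\<Sum>j<n+1. toeplitz_mat (\<lambda>i. if i = k then 1 else 0) n $$ (i,j)) \<le> (2::real)" .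
qed (auto simp: toeplitz_mat_def)

section \<open>Measurability of resolvents in the matrix entries\<close>

lemma borel_measurable_det:
  fixes A :: "'a \<Rightarrow> complex mat"
  assumes "\<And>\<omega>. A \<omega> \<in> carrier_mat N N"
    and "\<And>i j. i < N \<Longrightarrow> j < N \<Longrightarrow> (\<lambda>\<omega>. A \<omega> $$ (i,j)) \<in> borel_measurable M"
  shows "(\<lambda>\<omega>. det (A \<omega>)) \<in> borel_measurable M"
  unfolding det_def'[OF assms(1)]
proof (intro borel_measurable_sum borel_measurable_times borel_measurable_const borel_measurable_prod)
  fix p i assume "p \<in> {p. p permutes {0..<N}}" "i \<in> {0..<N}"
  then have "i < N" "p i < N" using permutes_in_image[of p "{0..<N}" i] by auto
  then show "(\<lambda>\<omega>. A \<omega> $$ (i, p i)) \<in> borel_measurable M" by (rule assms(2))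
qed

lemma borel_measurable_resolvent_index:
  assumes H: "\<And>\<omega>. H \<omega> \<in> carrier_mat N N"
    and Hm: "\<And>i j. i < N \<Longrightarrow> j < N \<Longrightarrow> (\<lambda>\<omega>. H \<omega> $$ (i,j)) \<in> borel_measurable M"
    and ij: "i < N" "j < N"
  shows "(\<lambda>\<omega>. resolvent (H \<omega>) z $$ (i,j)) \<in> borel_measurable M"
proof -
  have S: "shift_mat (H \<omega>) z \<in> carrier_mat N N" for \<omega> using H by simp
  have Sm: "(\<lambda>\<omega>. shift_mat (H \<omega>) z $$ (i,j)) \<in> borel_measurable M" if "i < N" "j < N" for i j
  proof -
    have "shift_mat (H \<omega>) z $$ (i,j) = z * (if i = j then 1 else 0) - of_real (H \<omega> $$ (i,j))" for \<omega>
      using H[of \<omega>] that by (auto simp: shift_mat_def)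
    moreover note Hm[OF that, measurable]
    ultimately show ?thesis by simp
  qed
  have D: "(\<lambda>\<omega>. det (mat_delete (shift_mat (H \<omega>) z) j i)) \<in> borel_measurable M"
  proof (rule borel_measurable_det)
    show "mat_delete (shift_mat (H \<omega>) z) j i \<in> carrier_mat (N - 1) (N - 1)" for \<omega>
      using S by (rule mat_delete_carrier)
    fix k l assume kl: "k < N - 1" "l < N - 1"
    have "mat_delete (shift_mat (H \<omega>) z) j i $$ (k,l) =
        shift_mat (H \<omega>) z $$ (if k < j then k else Suc k, if l < i then l else Suc l)" for \<omega>
      using S[of \<omega>] kl by (simp add: mat_delete_def)
    then show "(\<lambda>\<omega>. mat_delete (shift_mat (H \<omega>) z) j i $$ (k,l)) \<in> borel_measurable M"
      using kl by (auto intro!: Sm)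
  qed
  have "resolvent (H \<omega>) z $$ (i,j) = 1 / det (shift_mat (H \<omega>) z) * ((-1)^(j+i) * det (mat_delete (shift_mat (H \<omega>) z) j i))" for \<omega>
    using S[of \<omega>] ij by (simp add: resolvent_def adj_mat_def cofactor_def)
  then show ?thesis using D borel_measurable_det[OF S Sm] by simp
qed

lemma borel_measurable_trace_resolvent:
  assumes H: "\<And>\<omega>. H \<omega> \<in> symm_mats N" and z: "Im z > 0"
    and Hm: "\<And>i j. i < N \<Longrightarrow> j < N \<Longrightarrow> (\<lambda>\<omega>. H \<omega> $$ (i,j)) \<in> borel_measurable M"
  shows "(\<lambda>\<omega>. matrix_trace (resolvent (H \<omega>) z)) \<in> borel_measurable M"
proof -
  have "dim_row (resolvent (H \<omega>) z) = N" for \<omega> using resolvent_inverse(1)[OF H z] by auto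
  then show ?thesis unfolding matrix_trace_def
    using borel_measurable_resolvent_index[OF symm_mats_carrier[OF H] Hm] by auto
qed

lemma plane_energy_eq_sum:
  assumes H: "H \<in> symm_mats N" and z: "Im z > 0" and c: "c \<in> carrier_vec N" "s \<in> carrier_vec N"
  shows "plane_energy H z c s =
    - Im (\<Sum>i<N. \<Sum>k<N. of_real (c $ i * c $ k + s $ i * s $ k) * resolvent H z $$ (i,k))"
proof -
  note G = resolvent_inverse(1)[OF H z]
  have "map_vec complex_of_real x \<bullet> (resolvent H z *\<^sub>v map_vec complex_of_real x)
      = (\<Sum>i<N. \<Sum>k<N. of_real (x $ i * x $ k) * resolvent H z $$ (i,k))" if x: "x \<in> carrier_vec N" for x
  proof -
    have xc: "map_vec complex_of_real x \<in> carrier_vec N" using x by simp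
    have "map_vec complex_of_real x \<bullet> (resolvent H z *\<^sub>v map_vec complex_of_real x)
        = (\<Sum>i<N. of_real (x $ i) * (resolvent H z *\<^sub>v map_vec complex_of_real x) $ i)"
      using x G by (auto simp: scalar_prod_def lessThan_atLeast0 simp del: index_mult_mat_vec)
    also have "\<dots> = (\<Sum>i<N. of_real (x $ i) * (\<Sum>k<N. resolvent H z $$ (i,k) * of_real (x $ k)))"
      using index_mult_mat_vec_sum[OF G xc] x by (intro sum.cong) auto
    also have "\<dots> = (\<Sum>i<N. \<Sum>k<N. of_real (x $ i * x $ k) * resolvent H z $$ (i,k))"
      by (simp add: sum_distrib_left mult_ac)
    finally show ?thesis .
  qed
  note q = this
  show ?thesis unfolding plane_energy_def q[OF c(1)] q[OF c(2)]
    by (simp add: sum.distrib[symmetric] distrib_right)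
qed

section \<open>Discrete Fourier vectors and their Toeplitz projections\<close>

lemma sum_cos_roots_of_unity:
  assumes "d < N" "0 < d"
  shows "(\<Sum>j<N. cos (2 * pi * real j * real d / real N)) = 0"
proof -
  define w where "w = cis (2 * pi * real d / real N)"
  have N: "real N > 0" using assms by simp
  have "w \<noteq> 1"
  proof
    assume "w = 1"
    then have "cos (2 * pi * real d / real N) = 1" by (simp add: w_def complex_eq_iff)
    then obtain m :: int where m: "2 * pi * real d / real N = of_int m * 2 * pi"
      unfolding cos_one_2pi_int by blast
    then have "real d = of_int m * real N" using N by (simp add: field_simps)
    then have dm: "int d = m * int N" by (metis of_int_eq_iff of_int_mult of_int_of_nat_eq)
    have "0 < m * int N" unfolding dm[symmetric] using assms by simp
    then have "m > 0" by (rule zero_less_mult_pos2) (use assms in simp)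
    then have "int N \<le> int d" unfolding dm using mult_right_mono[of 1 m "int N"] by simp
    then show False using assms by simp
  qed
  moreover have "w ^ N = 1"
  proof -
    have "w ^ N = cis (2 * pi * real d)" using N unfolding w_def Complex.DeMoivre by simp
    also have "\<dots> = 1" by (metis cis_multiple_2pi Ints_of_nat)
    finally show ?thesis .
  qed
  ultimately have "(\<Sum>j<N. w ^ j) = 0" by (simp add: sum_gp_strict)
  then have "Re (\<Sum>j<N. w ^ j) = 0" by simp
  then show ?thesis unfolding w_def Complex.DeMoivre by (simp add: mult_ac)
qed

text \<open>\<open>dft_cos\<close> and \<open>dft_sin\<close> are the real and imaginary parts of
  the \<open>j\<close>-th normalised Fourier vector.\<close>

definition dft_cos :: "nat \<Rightarrow> nat \<Rightarrow> real vec" where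
  "dft_cos N j = vec N (\<lambda>i. cos (2 * pi * real j * real i / real N) / sqrt (real N))"

definition dft_sin :: "nat \<Rightarrow> nat \<Rightarrow> real vec" where
  "dft_sin N j = vec N (\<lambda>i. sin (2 * pi * real j * real i / real N) / sqrt (real N))"

lemma dft_carrier [simp]: "dft_cos N j \<in> carrier_vec N" "dft_sin N j \<in> carrier_vec N"
  by (auto simp: dft_cos_def dft_sin_def)

lemma dft_projection_index:
  assumes "i < N" "k < N"
  shows "dft_cos N j $ i * dft_cos N j $ k + dft_sin N j $ i * dft_sin N j $ k
    = cos (2 * pi * real j * real (if i \<le> k then k - i else i - k) / real N) / real N"
proof -
  have "cos (2 * pi * real j * real (if i \<le> k then k - i else i - k) / real N)
      = cos (2 * pi * real j * real i / real N - 2 * pi * real j * real k / real N)"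
  proof (cases "i \<le> k")
    case True
    then have "2 * pi * real j * real (k - i) / real N = - (2 * pi * real j * real i / real N - 2 * pi * real j * real k / real N)"
      by (simp add: of_nat_diff algebra_simps diff_divide_distrib)
    with True show ?thesis by (simp only: if_True cos_minus)
  next
    case False
    then have "2 * pi * real j * real (i - k) / real N = 2 * pi * real j * real i / real N - 2 * pi * real j * real k / real N"
      by (simp add: of_nat_diff algebra_simps diff_divide_distrib)
    with False show ?thesis by simp
  qed
  also have "\<dots> / real N = dft_cos N j $ i * dft_cos N j $ k + dft_sin N j $ i * dft_sin N j $ k"
    using assms by (simp add: cos_diff dft_cos_def dft_sin_def add_divide_distrib)
  finally show ?thesis ..
qed

text \<open>By the addition theorem the entries depend on \<open>|i - k|\<close> only. Hence moving
  a Toeplitz matrix in this direction is the same as shifting its random entries.\<close>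

lemma plane_mat_dft_toeplitz:
  "plane_mat (n+1) (dft_cos (n+1) j) (dft_sin (n+1) j)
    = toeplitz_mat (\<lambda>d. cos (2 * pi * real j * real d / real (n+1)) / real (n+1)) n"
proof (rule eq_matI)
  fix i k assume "i < dim_row (toeplitz_mat (\<lambda>d. cos (2 * pi * real j * real d / real (n+1)) / real (n+1)) n)"
    "k < dim_col (toeplitz_mat (\<lambda>d. cos (2 * pi * real j * real d / real (n+1)) / real (n+1)) n)"
  then have "i < n + 1" "k < n + 1" by (auto simp: toeplitz_mat_def)
  then show "plane_mat (n+1) (dft_cos (n+1) j) (dft_sin (n+1) j) $$ (i,k)
    = toeplitz_mat (\<lambda>d. cos (2 * pi * real j * real d / real (n+1)) / real (n+1)) n $$ (i,k)"
    using dft_projection_index[of i "n+1" k j] by (simp add: plane_mat_def toeplitz_mat_def)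
qed (auto simp: plane_mat_def toeplitz_mat_def)

text \<open>The Fourier vectors are orthonormal, so the matrices \<open>K_j\<close> add up to the
  identity and the energies to the full trace.\<close>

lemma sum_plane_energy_dft:
  assumes H: "H \<in> symm_mats N" and z: "Im z > 0" and N: "N > 0"
  shows "(\<Sum>j<N. plane_energy H z (dft_cos N j) (dft_sin N j)) = - Im (matrix_trace (resolvent H z))"
proof -
  let ?G = "resolvent H z"
  let ?P = "\<lambda>j i k. dft_cos N j $ i * dft_cos N j $ k + dft_sin N j $ i * dft_sin N j $ k"
  have orth: "(\<Sum>j<N. ?P j i k) = (if i = k then 1 else 0)" if ik: "i < N" "k < N" for i k
  proof (cases "i = k")
    case True
    then show ?thesis using dft_projection_index[OF ik] N by simp
  next
    case False
    let ?d = "if i \<le> k then k - i else i - k"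
    have "?d < N" "0 < ?d" using False ik by auto
    from sum_cos_roots_of_unity[OF this] show ?thesis
      using False unfolding dft_projection_index[OF ik] by (simp add: sum_divide_distrib[symmetric])
  qed
  have "(\<Sum>j<N. plane_energy H z (dft_cos N j) (dft_sin N j))
      = - Im (\<Sum>j<N. \<Sum>i<N. \<Sum>k<N. of_real (?P j i k) * ?G $$ (i,k))"
    by (simp add: plane_energy_eq_sum[OF H z dft_carrier] sum_negf)
  also have "(\<Sum>j<N. \<Sum>i<N. \<Sum>k<N. of_real (?P j i k) * ?G $$ (i,k))
      = (\<Sum>i<N. \<Sum>j<N. \<Sum>k<N. of_real (?P j i k) * ?G $$ (i,k))"
    by (rule sum.swap)
  also have "\<dots> = (\<Sum>i<N. \<Sum>k<N. \<Sum>j<N. of_real (?P j i k) * ?G $$ (i,k))"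
    by (intro sum.cong refl sum.swap)
  also have "\<dots> = (\<Sum>i<N. \<Sum>k<N. of_real (\<Sum>j<N. ?P j i k) * ?G $$ (i,k))"
    by (simp add: sum_distrib_right)
  also have "\<dots> = (\<Sum>i<N. \<Sum>k<N. if i = k then ?G $$ (i,k) else 0)"
    by (intro sum.cong refl) (simp add: orth)
  also have "\<dots> = matrix_trace ?G"
    using resolvent_inverse(1)[OF H z] by (auto simp: matrix_trace_def)
  finally show ?thesis .
qed

lemma borel_measurable_plane_energy:
  assumes H: "\<And>\<omega>. H \<omega> \<in> symm_mats N" and z: "Im z > 0"
    and Hm: "\<And>i j. i < N \<Longrightarrow> j < N \<Longrightarrow> (\<lambda>\<omega>. H \<omega> $$ (i,j)) \<in> borel_measurable M"
    and c: "c \<in> carrier_vec N" "s \<in> carrier_vec N"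
  shows "(\<lambda>\<omega>. plane_energy (H \<omega>) z c s) \<in> borel_measurable M"
proof -
  have "(\<lambda>\<omega>. \<Sum>i<N. \<Sum>k<N. of_real (c $ i * c $ k + s $ i * s $ k) * resolvent (H \<omega>) z $$ (i,k)) \<in> borel_measurable M"
    using borel_measurable_resolvent_index[OF symm_mats_carrier[OF H] Hm]
    by (intro borel_measurable_sum borel_measurable_times borel_measurable_const) auto
  then show ?thesis unfolding plane_energy_eq_sum[OF H z c] by measurable
qed

subsection \<open>Lindeberg replacement and Gaussian shifts\<close>

text \<open>Coordinates are exchanged one at a time. The one-coordinate estimate is required for
  every \<open>a\<close>, not only for points of the product space, so that slices of
  \<open>F\<close> satisfy it again in the induction.\<close>

lemma lindeberg_replacement:
  fixes F :: "('i \<Rightarrow> real) \<Rightarrow> real"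
  assumes "finite I"
    and \<nu>: "prob_space \<nu>" "sets \<nu> = sets borel" and \<mu>: "prob_space \<mu>" "sets \<mu> = sets borel"
    and "F \<in> borel_measurable (PiM I (\<lambda>_. borel))"
    and "\<And>a. \<bar>F a\<bar> \<le> B"
    and "\<And>k a. k \<in> I \<Longrightarrow> \<bar>(\<integral>x. F (a(k := x)) \<partial>\<nu>) - (\<integral>x. F (a(k := x)) \<partial>\<mu>)\<bar> \<le> e"
  shows "\<bar>(\<integral>a. F a \<partial>PiM I (\<lambda>_. \<nu>)) - (\<integral>a. F a \<partial>PiM I (\<lambda>_. \<mu>))\<bar> \<le> real (card I) * e"
  using assms(1,6-8)
proof (induction I arbitrary: F rule: finite_induct)
  case (insert k I)
  interpret \<nu>: prob_space \<nu> by fact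
  interpret \<mu>: prob_space \<mu> by fact
  interpret P\<nu>: product_prob_space "\<lambda>_. \<nu>" UNIV by unfold_locales
  interpret P\<mu>: product_prob_space "\<lambda>_. \<mu>" UNIV by unfold_locales
  let ?N = "PiM I (\<lambda>_. \<nu>)" and ?M = "PiM I (\<lambda>_. \<mu>)"
  interpret N: prob_space ?N by (intro prob_space_PiM \<nu>(1) \<mu>(1))
  interpret M: prob_space ?M by (intro prob_space_PiM \<nu>(1) \<mu>(1))
  interpret N\<mu>: pair_prob_space ?N \<mu> ..
  interpret M\<mu>: pair_prob_space ?M \<mu> ..
  have sN: "sets (PiM J (\<lambda>_. \<nu>)) = sets (PiM J (\<lambda>_. borel))" for J
    by (intro sets_PiM_cong) (auto simp: \<nu>)
  have sM: "sets (PiM J (\<lambda>_. \<mu>)) = sets (PiM J (\<lambda>_. borel))" for J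
    by (intro sets_PiM_cong) (auto simp: \<mu>)
  note [measurable_cong] = sN sM \<nu>(2) \<mu>(2)
  note [measurable] = insert.prems(1)
  have pair_meas: "(\<lambda>(a, x). F (a(k := x))) \<in> borel_measurable (PiM I (\<lambda>_. borel) \<Otimes>\<^sub>M borel)"
  proof -
    have "(\<lambda>p. (fst p)(k := snd p)) \<in> PiM I (\<lambda>_. borel) \<Otimes>\<^sub>M borel \<rightarrow>\<^sub>M PiM (insert k I) (\<lambda>_. borel)"
      by measurable
    from measurable_compose[OF this insert.prems(1)] show ?thesis by (simp add: case_prod_beta')
  qed
  then have [measurable]: "(\<lambda>(a, x). F (a(k := x))) \<in> borel_measurable (?N \<Otimes>\<^sub>M \<nu>)"
    "(\<lambda>(a, x). F (a(k := x))) \<in> borel_measurable (?N \<Otimes>\<^sub>M \<mu>)"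
    "(\<lambda>(a, x). F (a(k := x))) \<in> borel_measurable (?M \<Otimes>\<^sub>M \<mu>)"
    by (simp_all cong: measurable_cong_sets add: sets_pair_measure_cong[OF sN \<nu>(2)]
        sets_pair_measure_cong[OF sN \<mu>(2)] sets_pair_measure_cong[OF sM \<mu>(2)])
  have bnd: "\<bar>F a\<bar> \<le> B" for a by (rule insert.prems(2))
  have N\<mu>_int: "integrable (?N \<Otimes>\<^sub>M \<mu>) (\<lambda>(a, x). F (a(k := x)))"
    by (rule N\<mu>.integrable_const_bound[of _ B]) (auto simp: bnd)
  have M\<mu>_int: "integrable (?M \<Otimes>\<^sub>M \<mu>) (\<lambda>(a, x). F (a(k := x)))"
    by (rule M\<mu>.integrable_const_bound[of _ B]) (auto simp: bnd)
  have slice: "(\<lambda>a. F (a(k := x))) \<in> borel_measurable (PiM I (\<lambda>_. borel))" for x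
    using pair_meas by measurable
  \<comment> \<open>For arbitrary \<open>a\<close> the slice need not be known to be measurable; a
    nonintegrable function has integral 0, which respects the bound as well.\<close>
  have inner_bnd: "\<bar>\<integral>x. F (a(k := x)) \<partial>P\<bar> \<le> B" if "prob_space P" for a and P :: "real measure"
  proof (cases "integrable P (\<lambda>x. F (a(k := x)))")
    case True
    interpret P: prob_space P by fact
    have "\<bar>\<integral>x. F (a(k := x)) \<partial>P\<bar> \<le> (\<integral>x. \<bar>F (a(k := x))\<bar> \<partial>P)"
      by (rule integral_abs_bound)
    also have "\<dots> \<le> (\<integral>x. B \<partial>P)" using True bnd by (intro integral_mono) auto
    finally show ?thesis by (simp add: P.prob_space)
  next
    case False
    then show ?thesis using bnd[of undefined] by (simp add: not_integrable_integral_eq)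
  qed
  have i1: "integrable ?N (\<lambda>a. \<integral>x. F (a(k := x)) \<partial>\<nu>)"
    by (rule N.integrable_const_bound[of _ B]) (auto simp: inner_bnd[OF \<nu>(1)] inner_bnd[OF \<mu>(1)])
  have i2: "integrable ?N (\<lambda>a. \<integral>x. F (a(k := x)) \<partial>\<mu>)"
    by (rule N.integrable_const_bound[of _ B]) (auto simp: inner_bnd[OF \<nu>(1)] inner_bnd[OF \<mu>(1)])
  interpret PN: prob_space "PiM (insert k I) (\<lambda>_. \<nu>)" by (intro prob_space_PiM \<nu>(1) \<mu>(1))
  interpret PM: prob_space "PiM (insert k I) (\<lambda>_. \<mu>)" by (intro prob_space_PiM \<nu>(1) \<mu>(1))
  have fN: "(\<integral>a. F a \<partial>PiM (insert k I) (\<lambda>_. \<nu>)) = (\<integral>a. (\<integral>x. F (a(k := x)) \<partial>\<nu>) \<partial>?N)"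
    using insert.hyps by (intro P\<nu>.product_integral_insert PN.integrable_const_bound[of _ B]) (auto simp: bnd)
  have fM: "(\<integral>a. F a \<partial>PiM (insert k I) (\<lambda>_. \<mu>)) = (\<integral>a. (\<integral>x. F (a(k := x)) \<partial>\<mu>) \<partial>?M)"
    using insert.hyps by (intro P\<mu>.product_integral_insert PM.integrable_const_bound[of _ B]) (auto simp: bnd)
  \<comment> \<open>With coordinate \<open>k\<close> already distributed as the target law, Fubini
    puts it outside, and the induction hypothesis exchanges the others for each fixed
    \<open>x\<close>.\<close>
  have "(\<integral>a. (\<integral>x. F (a(k := x)) \<partial>\<mu>) \<partial>?M) = (\<integral>x. (\<integral>a. F (a(k := x)) \<partial>?M) \<partial>\<mu>)"
    using M\<mu>.Fubini_integral[OF M\<mu>_int] by simp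
  moreover have "(\<integral>a. (\<integral>x. F (a(k := x)) \<partial>\<mu>) \<partial>?N) = (\<integral>x. (\<integral>a. F (a(k := x)) \<partial>?N) \<partial>\<mu>)"
    using N\<mu>.Fubini_integral[OF N\<mu>_int] by simp
  moreover have "integrable \<mu> (\<lambda>x. \<integral>a. F (a(k := x)) \<partial>?M)" "integrable \<mu> (\<lambda>x. \<integral>a. F (a(k := x)) \<partial>?N)"
    using M\<mu>.integrable_snd[OF M\<mu>_int] N\<mu>.integrable_snd[OF N\<mu>_int] by simp_all
  ultimately have "\<bar>(\<integral>a. (\<integral>x. F (a(k := x)) \<partial>\<mu>) \<partial>?N) - (\<integral>a. (\<integral>x. F (a(k := x)) \<partial>\<mu>) \<partial>?M)\<bar>
      = \<bar>\<integral>x. (\<integral>a. F (a(k := x)) \<partial>?N) - (\<integral>a. F (a(k := x)) \<partial>?M) \<partial>\<mu>\<bar>"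
    by simp
  also have "\<dots> \<le> (\<integral>x. \<bar>(\<integral>a. F (a(k := x)) \<partial>?N) - (\<integral>a. F (a(k := x)) \<partial>?M)\<bar> \<partial>\<mu>)"
    by (rule integral_abs_bound)
  also have "\<dots> \<le> (\<integral>x. real (card I) * e \<partial>\<mu>)"
  proof (rule integral_mono)
    fix x
    show "\<bar>(\<integral>a. F (a(k := x)) \<partial>?N) - (\<integral>a. F (a(k := x)) \<partial>?M)\<bar> \<le> real (card I) * e"
    proof (rule insert.IH[OF slice])
      fix j a assume j: "j \<in> I"
      then have "j \<noteq> k" using insert.hyps by auto
      then have eq: "(a(j := y))(k := x) = (a(k := x))(j := y)" for y by (rule fun_upd_twist)
      show "\<bar>(\<integral>y. F ((a(j := y))(k := x)) \<partial>\<nu>) - (\<integral>y. F ((a(j := y))(k := x)) \<partial>\<mu>)\<bar> \<le> e"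
        unfolding eq by (rule insert.prems(3)) (use j in simp)
    qed (rule bnd)
  qed (use M\<mu>.integrable_snd[OF M\<mu>_int] N\<mu>.integrable_snd[OF N\<mu>_int] in auto)
  also have "\<dots> = real (card I) * e" by (simp add: \<mu>.prob_space)
  finally have 2: "\<bar>(\<integral>a. (\<integral>x. F (a(k := x)) \<partial>\<mu>) \<partial>?N) - (\<integral>a. (\<integral>x. F (a(k := x)) \<partial>\<mu>) \<partial>?M)\<bar> \<le> real (card I) * e" .
  \<comment> \<open>The remaining exchange of coordinate \<open>k\<close> itself, while all others
    keep the law \<open>\<nu>\<close>.\<close>
  have "\<bar>(\<integral>a. (\<integral>x. F (a(k := x)) \<partial>\<nu>) \<partial>?N) - (\<integral>a. (\<integral>x. F (a(k := x)) \<partial>\<mu>) \<partial>?N)\<bar>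
      = \<bar>\<integral>a. (\<integral>x. F (a(k := x)) \<partial>\<nu>) - (\<integral>x. F (a(k := x)) \<partial>\<mu>) \<partial>?N\<bar>"
    using i1 i2 by simp
  also have "\<dots> \<le> (\<integral>a. \<bar>(\<integral>x. F (a(k := x)) \<partial>\<nu>) - (\<integral>x. F (a(k := x)) \<partial>\<mu>)\<bar> \<partial>?N)"
    by (rule integral_abs_bound)
  also have "\<dots> \<le> (\<integral>a. e \<partial>?N)"
    by (intro integral_mono integrable_abs Bochner_Integration.integrable_diff i1 i2 insert.prems(3) insertI1) auto
  also have "\<dots> = e" by (simp add: N.prob_space)
  finally show ?case using 2 insert.hyps unfolding fN fM by (simp add: algebra_simps)
qed (simp add: PiM_empty)

lemma quadratic_approx_expectation:
  fixes f :: "real \<Rightarrow> real"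
  assumes P: "prob_space M" and M: "sets M = sets borel" and i2: "integrable M (\<lambda>x. x^2)"
    and f: "f \<in> borel_measurable borel" and B: "\<And>x. \<bar>f x\<bar> \<le> B"
    and m: "m \<in> borel_measurable borel" and mb: "\<And>x. 0 \<le> m x" "\<And>x. m x \<le> c * x^2"
    and approx: "\<And>x. \<bar>f x - (c0 + c1 * x + c2 * x^2)\<bar> \<le> m x"
  shows "\<bar>(\<integral>x. f x \<partial>M) - (c0 + c1 * (\<integral>x. x \<partial>M) + c2 * (\<integral>x. x^2 \<partial>M))\<bar> \<le> (\<integral>x. m x \<partial>M)"
proof -
  interpret prob_space M by fact
  note [measurable_cong] = M
  note [measurable] = f m
  have 1: "integrable M (\<lambda>x. x)"
    by (rule square_integrable_imp_integrable[OF _ i2]) measurable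
  have 2: "integrable M f"
    by (rule integrable_const_bound[of _ B]) (auto simp: B)
  have "integrable M (\<lambda>x. c * x^2)" using i2 by simp
  then have 3: "integrable M m"
  proof (rule Bochner_Integration.integrable_bound)
    have "norm (m x) \<le> norm (c * x^2)" for x
      using mb(1)[of x] mb(2)[of x] by simp
    then show "AE x in M. norm (m x) \<le> norm (c * x^2)" by simp
  qed measurable
  have 4: "integrable M (\<lambda>x. c0 + c1 * x + c2 * x^2)"
    using 1 i2 by simp
  have "(\<integral>x. c0 + c1 * x + c2 * x^2 \<partial>M) = c0 + c1 * (\<integral>x. x \<partial>M) + c2 * (\<integral>x. x^2 \<partial>M)"
    using 1 i2 by (simp add: prob_space)
  then have "\<bar>(\<integral>x. f x \<partial>M) - (c0 + c1 * (\<integral>x. x \<partial>M) + c2 * (\<integral>x. x^2 \<partial>M))\<bar>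
      = \<bar>\<integral>x. f x - (c0 + c1 * x + c2 * x^2) \<partial>M\<bar>"
    using Bochner_Integration.integral_diff[OF 2 4] by simp
  also have "\<dots> \<le> (\<integral>x. \<bar>f x - (c0 + c1 * x + c2 * x^2)\<bar> \<partial>M)"
    by (rule integral_abs_bound)
  also have "\<dots> \<le> (\<integral>x. m x \<partial>M)"
    by (intro integral_mono integrable_abs Bochner_Integration.integrable_diff 2 3 4 approx)
  finally show ?thesis .
qed

text \<open>Equal first and second moments cancel the quadratic polynomial, leaving the two
  integrated remainders. The bound by a multiple of \<open>x^2\<close> makes the remainder
  integrable.\<close>

lemma moment_matching_replacement:
  fixes f :: "real \<Rightarrow> real"
  assumes \<nu>: "prob_space \<nu>" "sets \<nu> = sets borel" and \<mu>: "prob_space \<mu>" "sets \<mu> = sets borel"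
    and i2: "integrable \<nu> (\<lambda>x. x^2)" "integrable \<mu> (\<lambda>x. x^2)"
    and m1: "(\<integral>x. x \<partial>\<nu>) = (\<integral>x. x \<partial>\<mu>)" and m2: "(\<integral>x. x^2 \<partial>\<nu>) = (\<integral>x. x^2 \<partial>\<mu>)"
    and f: "f \<in> borel_measurable borel" and B: "\<And>x. \<bar>f x\<bar> \<le> B"
    and m: "m \<in> borel_measurable borel" and mb: "\<And>x. 0 \<le> m x" "\<And>x. m x \<le> c * x^2"
    and approx: "\<And>x. \<bar>f x - (c0 + c1 * x + c2 * x^2)\<bar> \<le> m x"
  shows "\<bar>(\<integral>x. f x \<partial>\<nu>) - (\<integral>x. f x \<partial>\<mu>)\<bar> \<le> (\<integral>x. m x \<partial>\<nu>) + (\<integral>x. m x \<partial>\<mu>)"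
  using quadratic_approx_expectation[OF \<nu> i2(1) f B m mb approx]
    quadratic_approx_expectation[OF \<mu> i2(2) f B m mb approx] m1 m2 by simp

text \<open>Dominated convergence with majorant \<open>x^2\<close>. This takes the place of a finite
  third moment.\<close>

lemma truncated_third_moment_tendsto_0:
  fixes \<nu> :: "real measure"
  assumes "sets \<nu> = sets borel" "integrable \<nu> (\<lambda>x. x^2)" "s \<longlonglongrightarrow> (0 :: real)"  "\<And>n. 0 \<le> s n"
  shows "(\<lambda>n. \<integral>x. min (x^2) (s n * \<bar>x\<bar>^3) \<partial>\<nu>) \<longlonglongrightarrow> 0"
proof -
  note [measurable_cong] = assms(1)
  have "(\<lambda>n. \<integral>x. min (x^2) (s n * \<bar>x\<bar>^3) \<partial>\<nu>) \<longlonglongrightarrow> (\<integral>x. 0 \<partial>\<nu>)"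
  proof (rule integral_dominated_convergence[where w = "\<lambda>x. x^2"])
    show "AE x in \<nu>. (\<lambda>n. min (x^2) (s n * \<bar>x\<bar>^3)) \<longlonglongrightarrow> 0"
    proof (rule AE_I2)
      fix x :: real
      have "(\<lambda>n. min (x^2) (s n * \<bar>x\<bar>^3)) \<longlonglongrightarrow> min (x^2) (0 * \<bar>x\<bar>^3)"
        by (intro tendsto_intros assms)
      then show "(\<lambda>n. min (x^2) (s n * \<bar>x\<bar>^3)) \<longlonglongrightarrow> 0" by simp
    qed
    show "AE x in \<nu>. norm (min (x\<^sup>2) (s n * \<bar>x\<bar> ^ 3)) \<le> x\<^sup>2" for n
      using assms(4)[of n] by (auto simp: abs_of_nonneg)
  qed (use assms in auto)
  then show ?thesis by simp
qed


section \<open>Gaussian laws under shifts\<close>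

abbreviation gaussian :: "real \<Rightarrow> real measure" where
  "gaussian m \<equiv> density lborel (\<lambda>x. ennreal (normal_density m 1 x))"

lemma gaussian_prob_space: "prob_space (gaussian m)"
  by (rule prob_space_normal_density) simp

lemma gaussian_moments:
  "integrable (gaussian m) (\<lambda>x. x^2)" "(\<integral>x. x \<partial>gaussian m) = m" "(\<integral>x. x^2 \<partial>gaussian m) = 1 + m^2"
proof -
  have i: "integrable lborel (\<lambda>x. normal_density m 1 x)" "integrable lborel (\<lambda>x. normal_density m 1 x * x)"
      "integrable lborel (\<lambda>x. normal_density m 1 x * (x - m)^2)"
    using integrable_normal_moment_nz_1[of 1 m] integrable_normal_moment[of 1 m 2] by auto
  have e: "normal_density m 1 x * x^2 = normal_density m 1 x * (x - m)^2 + 2 * m * (normal_density m 1 x * x) - m^2 * normal_density m 1 x" for x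
    by (simp add: algebra_simps power2_eq_square)
  show "integrable (gaussian m) (\<lambda>x. x^2)"
    using i by (subst integrable_density) (auto simp: e)
  show "(\<integral>x. x \<partial>gaussian m) = m"
    using integral_normal_moment_nz_1[of 1 m] by (subst integral_density) auto
  have "(\<integral>x. normal_density m 1 x * (x - m)^2 \<partial>lborel) = 1"
    using integral_normal_moment_even[of 1 m 1] by simp
  then have "(\<integral>x. normal_density m 1 x * x^2 \<partial>lborel) = 1 + m^2"
    using i integral_normal_moment_nz_1[of 1 m] unfolding e by (simp add: power2_eq_square)
  then show "(\<integral>x. x^2 \<partial>gaussian m) = 1 + m^2"
    by (subst integral_density) auto
qed

text \<open>The one-dimensional Cameron-Martin formula: the weight is the ratio of the normal
  densities at \<open>x + s\<close> and \<open>x\<close>.\<close>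

lemma gaussian_translate:
  assumes [measurable]: "h \<in> borel_measurable borel"
  shows "(\<integral>\<^sup>+x. h x \<partial>gaussian m)
    = (\<integral>\<^sup>+x. ennreal (exp (- s * (x - m) - s^2 / 2)) * h (x + s) \<partial>gaussian m)"
proof -
  have d: "normal_density m 1 (x + s) = normal_density m 1 x * exp (- s * (x - m) - s^2 / 2)" for x
    by (simp add: normal_density_def exp_add[symmetric] field_simps power2_eq_square)
  have "(\<integral>\<^sup>+x. h x \<partial>gaussian m) = (\<integral>\<^sup>+x. ennreal (normal_density m 1 x) * h x \<partial>lborel)"
    by (subst nn_integral_density) auto
  also have "\<dots> = (\<integral>\<^sup>+x. ennreal (normal_density m 1 (x + s)) * h (x + s) \<partial>lborel)"
    by (subst nn_integral_real_affine[where c = 1 and t = s]) (auto simp: add.commute)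
  also have "\<dots> = (\<integral>\<^sup>+x. ennreal (normal_density m 1 x) * (ennreal (exp (- s * (x - m) - s^2 / 2)) * h (x + s)) \<partial>lborel)"
    unfolding d by (intro nn_integral_cong) (simp add: ennreal_mult mult_ac)
  also have "\<dots> = (\<integral>\<^sup>+x. ennreal (exp (- s * (x - m) - s^2 / 2)) * h (x + s) \<partial>gaussian m)"
    by (subst nn_integral_density) auto
  finally show ?thesis .
qed

lemma gaussian_product_translate:
  fixes u :: "'i \<Rightarrow> real"
  assumes I: "finite I" and h: "h \<in> borel_measurable (PiM I (\<lambda>_. borel))"
  shows "(\<integral>\<^sup>+g. h g \<partial>PiM I (\<lambda>_. gaussian m)) =
    (\<integral>\<^sup>+g. ennreal (exp (- (\<Sum>k\<in>I. u k * (g k - m)) - (\<Sum>k\<in>I. (u k)^2) / 2)) * h (\<lambda>k\<in>I. g k + u k)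
      \<partial>PiM I (\<lambda>_. gaussian m))"
proof -
  interpret G: prob_space "gaussian m" by (rule gaussian_prob_space)
  interpret P: product_prob_space "\<lambda>_. gaussian m" UNIV by unfold_locales
  have [measurable_cong]: "sets (PiM I (\<lambda>_. gaussian m)) = sets (PiM I (\<lambda>_. borel))"
    by (intro sets_PiM_cong) auto
  note [measurable] = h
  let ?P = "PiM I (\<lambda>_. gaussian m)"
  define w where "w = (\<lambda>k x. ennreal (exp (- u k * (x - m) - (u k)^2 / 2)))"
  have [measurable]: "w k \<in> borel_measurable borel" for k unfolding w_def by measurable
  let ?W = "\<lambda>g. \<Prod>k\<in>I. w k (g k)"
  let ?T = "\<lambda>g. \<lambda>k\<in>I. g k + u k"
  have T[measurable]: "?T \<in> PiM I (\<lambda>_. borel) \<rightarrow>\<^sub>M PiM I (\<lambda>_. borel)" by measurable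
  have W: "?W g = ennreal (exp (- (\<Sum>k\<in>I. u k * (g k - m)) - (\<Sum>k\<in>I. (u k)^2) / 2))" for g
    unfolding w_def using I
    by (simp add: prod_ennreal exp_sum[symmetric] sum_subtractf sum_negf sum_divide_distrib)
  have Wm[measurable]: "?W \<in> borel_measurable (PiM I (\<lambda>_. borel))" by measurable
  \<comment> \<open>The weighted law, translated, is the product law again. This is checked on
    boxes, where both sides factor into one-dimensional translations.\<close>
  have "distr (density ?P ?W) (PiM I (\<lambda>_. borel)) ?T = ?P"
  proof (rule P.PiM_eqI[OF I])
    show "sets (distr (density ?P ?W) (PiM I (\<lambda>_. borel)) ?T) = sets ?P"
      by (simp cong: sets_PiM_cong)
    fix A :: "'i \<Rightarrow> real set" assume A: "\<And>i. i \<in> I \<Longrightarrow> A i \<in> sets (gaussian m)"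
    then have A': "A i \<in> sets borel" if "i \<in> I" for i using that by simp
    have PA[measurable]: "Pi\<^sub>E I A \<in> sets (PiM I (\<lambda>_. borel))"
      using A' I by (intro sets_PiM_I_finite) auto
    have "emeasure (distr (density ?P ?W) (PiM I (\<lambda>_. borel)) ?T) (Pi\<^sub>E I A)
        = (\<integral>\<^sup>+g. indicator (Pi\<^sub>E I A) g \<partial>distr (density ?P ?W) (PiM I (\<lambda>_. borel)) ?T)"
      by (subst nn_integral_indicator) auto
    also have "\<dots> = (\<integral>\<^sup>+g. ?W g * indicator (Pi\<^sub>E I A) (?T g) \<partial>?P)"
      by (subst nn_integral_distr, measurable, subst nn_integral_density) auto
    also have "\<dots> = (\<integral>\<^sup>+g. (\<Prod>k\<in>I. w k (g k) * indicator (A k) (g k + u k)) \<partial>?P)"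
    proof (intro nn_integral_cong)
      fix g
      have "indicator (Pi\<^sub>E I A) (?T g) = (\<Prod>k\<in>I. indicator (A k) (g k + u k) :: ennreal)"
        using I by (auto simp: indicator_def PiE_iff prod_zero_iff)
      then show "?W g * indicator (Pi\<^sub>E I A) (?T g) = (\<Prod>k\<in>I. w k (g k) * indicator (A k) (g k + u k))"
        by (simp add: prod.distrib)
    qed
    also have "\<dots> = (\<Prod>k\<in>I. \<integral>\<^sup>+x. w k x * indicator (A k) (x + u k) \<partial>gaussian m)"
      using I A' by (intro P.product_nn_integral_prod) auto
    also have "\<dots> = (\<Prod>k\<in>I. emeasure (gaussian m) (A k))"
    proof (intro prod.cong refl)
      fix k assume k: "k \<in> I"
      have "(\<integral>\<^sup>+x. indicator (A k) x \<partial>gaussian m) = (\<integral>\<^sup>+x. w k x * indicator (A k) (x + u k) \<partial>gaussian m)"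
        unfolding w_def using A'[OF k] by (intro gaussian_translate) auto
      then show "(\<integral>\<^sup>+x. w k x * indicator (A k) (x + u k) \<partial>gaussian m) = emeasure (gaussian m) (A k)"
        using A[OF k] by simp
    qed
    finally show "emeasure (distr (density ?P ?W) (PiM I (\<lambda>_. borel)) ?T) (Pi\<^sub>E I A) = (\<Prod>k\<in>I. emeasure (gaussian m) (A k))" .
  qed
  then have "(\<integral>\<^sup>+g. h g \<partial>?P) = (\<integral>\<^sup>+g. h g \<partial>distr (density ?P ?W) (PiM I (\<lambda>_. borel)) ?T)"
    by simp
  also have "\<dots> = (\<integral>\<^sup>+g. ?W g * h (?T g) \<partial>?P)"
    by (subst nn_integral_distr, measurable, subst nn_integral_density) auto
  finally show ?thesis unfolding W .
qed

text \<open>The integral is rewritten by a shift of \<open>t * u\<close> for each \<open>t\<close>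
  in \<open>[-1, 1]\<close>, and the results are averaged. Since the weight has a majorant free of
  \<open>t\<close>, the integral over \<open>t\<close> can be done at fixed \<open>g\<close>, where
  it costs \<open>B\<close>.\<close>

lemma gaussian_directional_smoothing:
  fixes u :: "'i \<Rightarrow> real" and h :: "('i \<Rightarrow> real) \<Rightarrow> ennreal"
  assumes I: "finite I" and h: "h \<in> borel_measurable (PiM I (\<lambda>_. borel))"
    and u: "(\<Sum>k\<in>I. (u k)^2) \<le> 1"
    and B: "\<And>g. (\<integral>\<^sup>+t. h (\<lambda>k\<in>I. g k + t * u k) * indicator {-1..1} t \<partial>lborel) \<le> ennreal B" and "0 \<le> B"
  shows "(\<integral>\<^sup>+g. h g \<partial>PiM I (\<lambda>_. gaussian m)) \<le> ennreal (exp (1/2) * B)"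
proof -
  let ?P = "PiM I (\<lambda>_. gaussian m)"
  interpret P: prob_space ?P by (intro prob_space_PiM gaussian_prob_space)
  interpret PL: pair_sigma_finite ?P lborel ..
  have sP[measurable_cong]: "sets ?P = sets (PiM I (\<lambda>_. borel))"
    by (intro sets_PiM_cong) auto
  note [measurable] = h
  define X where "X = (\<lambda>g. \<Sum>k\<in>I. u k * (g k - m))"
  define q where "q = (\<Sum>k\<in>I. (u k)^2)"
  have [measurable]: "X \<in> borel_measurable (PiM I (\<lambda>_. borel))" unfolding X_def by measurable
  have scale: "(\<Sum>k\<in>I. t * u k * (g k - m)) = t * X g" "(\<Sum>k\<in>I. (t * u k)^2) = t^2 * q" for t g
    by (simp_all add: X_def q_def sum_distrib_left mult_ac power_mult_distrib)
  have tr: "(\<integral>\<^sup>+g. k g \<partial>?P) = (\<integral>\<^sup>+g. ennreal (exp (- (t * X g) - t^2 * q / 2)) * k (\<lambda>k\<in>I. g k + t * u k) \<partial>?P)"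
    if "k \<in> borel_measurable (PiM I (\<lambda>_. borel))" for k t
    using gaussian_product_translate[OF I that, of m "\<lambda>k. t * u k"] by (simp only: scale)
  \<comment> \<open>The exponential moment comes from the shift formula itself: applied to the
    constant 1 it says that the weight has mean 1, so the mean here is
    \<open>exp (q / 2)\<close>.\<close>
  have mgf: "(\<integral>\<^sup>+g. ennreal (exp (- (t * X g))) \<partial>?P) \<le> ennreal (exp (1/2))" if t: "t^2 = 1" for t
  proof -
    have "1 = (\<integral>\<^sup>+g. ennreal (exp (- (t * X g) - q / 2)) \<partial>?P)"
      using tr[of "\<lambda>_. 1" t] t by (simp add: P.emeasure_space_1)
    also have "\<dots> = (\<integral>\<^sup>+g. ennreal (exp (- q / 2)) * ennreal (exp (- (t * X g))) \<partial>?P)"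
      by (intro nn_integral_cong) (simp add: ennreal_mult[symmetric] exp_add[symmetric])
    also have "\<dots> = ennreal (exp (- q / 2)) * (\<integral>\<^sup>+g. ennreal (exp (- (t * X g))) \<partial>?P)"
      by (rule nn_integral_cmult) measurable
    finally have "ennreal (exp (q / 2)) = ennreal (exp (q/2)) * (ennreal (exp (- q / 2)) * (\<integral>\<^sup>+g. ennreal (exp (- (t * X g))) \<partial>?P))"
      by simp
    also have "\<dots> = (\<integral>\<^sup>+g. ennreal (exp (- (t * X g))) \<partial>?P)"
      by (simp add: mult.assoc[symmetric] ennreal_mult[symmetric] exp_add[symmetric])
    finally show ?thesis using u by (metis q_def ennreal_leI exp_le_cancel_iff divide_right_mono zero_le_numeral)
  qed
  let ?E = "\<lambda>g. ennreal (exp (X g)) + ennreal (exp (- X g))"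
  \<comment> \<open>The 2 is the length of \<open>[-1, 1]\<close>; it cancels against the two
    exponentials in \<open>?E\<close>.\<close>
  have "2 * (\<integral>\<^sup>+g. h g \<partial>?P) = (\<integral>\<^sup>+t. (\<integral>\<^sup>+g. h g \<partial>?P) * indicator {-1..1::real} t \<partial>lborel)"
    by (subst nn_integral_cmult_indicator) (auto simp: mult.commute)
  also have "\<dots> \<le> (\<integral>\<^sup>+t. (\<integral>\<^sup>+g. ?E g * (h (\<lambda>k\<in>I. g k + t * u k) * indicator {-1..1} t) \<partial>?P) \<partial>lborel)"
  proof (intro nn_integral_mono)
    fix t :: real
    show "(\<integral>\<^sup>+g. h g \<partial>?P) * indicator {-1..1} t \<le> (\<integral>\<^sup>+g. ?E g * (h (\<lambda>k\<in>I. g k + t * u k) * indicator {-1..1} t) \<partial>?P)"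
    proof (cases "t \<in> {-1..1}")
      case True
      have "ennreal (exp (- (t * X g) - t^2 * q / 2)) \<le> ?E g" for g
      proof -
        have "q \<ge> 0" by (simp add: q_def sum_nonneg)
        then have "- (t * X g) - t^2 * q / 2 \<le> \<bar>X g\<bar>"
          using True mult_right_mono[of "\<bar>t\<bar>" 1 "\<bar>X g\<bar>"] abs_ge_self[of "- (t * X g)"]
          by (auto simp: abs_mult) (smt (verit) mult_nonneg_nonneg zero_le_power2 divide_nonneg_nonneg)
        then have "exp (- (t * X g) - t^2 * q / 2) \<le> exp \<bar>X g\<bar>" by simp
        also have "\<dots> \<le> exp (X g) + exp (- X g)" by (cases "X g \<ge> 0") auto
        finally show ?thesis by (simp add: ennreal_plus[symmetric] ennreal_leI del: ennreal_plus)
      qed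
      then have "(\<integral>\<^sup>+g. h g \<partial>?P) \<le> (\<integral>\<^sup>+g. ?E g * h (\<lambda>k\<in>I. g k + t * u k) \<partial>?P)"
        unfolding tr[OF h, of t] by (intro nn_integral_mono mult_right_mono) auto
      then show ?thesis using True by simp
    qed simp
  qed
  also have "\<dots> = (\<integral>\<^sup>+g. (\<integral>\<^sup>+t. ?E g * (h (\<lambda>k\<in>I. g k + t * u k) * indicator {-1..1} t) \<partial>lborel) \<partial>?P)"
    by (rule PL.Fubini') measurable
  also have "\<dots> \<le> (\<integral>\<^sup>+g. ?E g * ennreal B \<partial>?P)"
  proof (intro nn_integral_mono)
    fix g assume "g \<in> space ?P"
    then have g: "g \<in> space (PiM I (\<lambda>_. borel))" using sets_eq_imp_space_eq[OF sP] by simp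
    have "(\<lambda>t. \<lambda>k\<in>I. g k + t * u k) \<in> lborel \<rightarrow>\<^sub>M PiM I (\<lambda>_. borel)" by measurable
    then have [measurable]: "(\<lambda>t. h (\<lambda>k\<in>I. g k + t * u k)) \<in> borel_measurable lborel"
      using h by (rule measurable_compose)
    show "(\<integral>\<^sup>+t. ?E g * (h (\<lambda>k\<in>I. g k + t * u k) * indicator {-1..1} t) \<partial>lborel) \<le> ?E g * ennreal B"
      by (subst nn_integral_cmult) (auto intro!: mult_left_mono B)
  qed
  also have "\<dots> = (\<integral>\<^sup>+g. ?E g \<partial>?P) * ennreal B"
    by (rule nn_integral_multc) measurable
  also have "(\<integral>\<^sup>+g. ?E g \<partial>?P) = (\<integral>\<^sup>+g. ennreal (exp (X g)) \<partial>?P) + (\<integral>\<^sup>+g. ennreal (exp (- X g)) \<partial>?P)"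
    by (intro nn_integral_add) measurable
  also have "\<dots> * ennreal B \<le> (ennreal (exp (1/2)) + ennreal (exp (1/2))) * ennreal B"
    using mgf[of 1] mgf[of "-1"] by (intro mult_right_mono add_mono) auto
  also have "\<dots> = 2 * ennreal (exp (1/2) * B)"
    using \<open>0 \<le> B\<close> by (simp add: ennreal_mult mult_2 distrib_right)
  finally have "(2 * (\<integral>\<^sup>+g. h g \<partial>?P)) \<le> 2 * ennreal (exp (1/2) * B)" .
  then show ?thesis
    by (subst (asm) ennreal_mult_le_mult_iff) auto
qed

subsection \<open>Measures with bounded Poisson integral\<close>

lemma arctan_kernel_integral:
  fixes x y a b :: real
  assumes "y > 0" "a \<le> b"
  shows "(\<integral>\<^sup>+e. ennreal (y / ((e - x)^2 + y^2)) * indicator {a..b} e \<partial>lborel)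
    = ennreal (arctan ((b - x) / y) - arctan ((a - x) / y))"
proof (rule nn_integral_FTC_Icc)
  fix e
  have "inverse (1 + ((e - x) / y)^2) * (1 / y) = y / ((e - x)^2 + y^2)"
  proof -
    have "1 + ((e - x) / y)^2 = ((e - x)^2 + y^2) / y^2"
      using assms by (simp add: power_divide add_divide_distrib)
    then show ?thesis using assms by (simp add: power2_eq_square)
  qed
  moreover have "((\<lambda>e. arctan ((e - x) / y)) has_real_derivative (inverse (1 + ((e - x) / y)^2) * (1 / y))) (at e)"
    using assms by (auto intro!: derivative_eq_intros simp del: power_divide)
  ultimately show "((\<lambda>e. arctan ((e - x) / y)) has_real_derivative (y / ((e - x)^2 + y^2))) (at e)"
    by simp
qed (use assms in auto)

text \<open>Integrate the Poisson bound over \<open>e\<close> in the window enlarged by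
  \<open>d\<close> on both sides. With \<open>y = d / k\<close> every point of \<open>{a..b}\<close>
  is at least \<open>k\<close> heights away from the ends of the window, so it receives mass at
  least \<open>2 * arctan k\<close>. Let \<open>k\<close> tend to infinity, which gives
  \<open>pi\<close>, and then \<open>d\<close> to 0.\<close>

lemma poisson_bound_interval:
  fixes \<gamma> :: "real measure"
  assumes "prob_space \<gamma>" and s: "sets \<gamma> = sets borel" and C: "0 \<le> C"
    and bound: "\<And>e y. y > 0 \<Longrightarrow> (\<integral>x. y / ((e - x)^2 + y^2) \<partial>\<gamma>) \<le> pi * C" and ab: "a \<le> b"
  shows "measure \<gamma> {a..b} \<le> C * (b - a)"
proof -
  interpret prob_space \<gamma> by fact
  interpret PL: pair_sigma_finite \<gamma> lborel ..
  note [measurable_cong] = s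
  have fin: "measure \<gamma> {a..b} * (2 * arctan k) \<le> pi * C * (b - a + 2 * d)" if d: "d > 0" and k: "k > 0" for d k :: real
  proof -
    define y where "y = d / k"
    have y: "y > 0" "d / y = k" using d k by (auto simp: y_def)
    have dpos: "(e - x)^2 + y^2 > 0" for e x using y(1) by (simp add: add_nonneg_pos)
    have p: "(\<integral>\<^sup>+x. ennreal (y / ((e - x)^2 + y^2)) \<partial>\<gamma>) \<le> ennreal (pi * C)" for e
    proof -
      have "y / ((e - x)^2 + y^2) \<le> 1 / y" for x
        using y(1) dpos[of e x] by (simp add: divide_simps power2_eq_square)
      then have "integrable \<gamma> (\<lambda>x. y / ((e - x)^2 + y^2))"
        using y(1) by (intro integrable_const_bound[of _ "1/y"]) (auto simp: abs_of_nonneg)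
      then show ?thesis
        using bound[OF y(1)] y(1) by (subst nn_integral_eq_integral) (auto intro: ennreal_leI)
    qed
    have "ennreal (measure \<gamma> {a..b} * (2 * arctan k)) = (\<integral>\<^sup>+x. ennreal (2 * arctan k) * indicator {a..b} x \<partial>\<gamma>)"
      using k by (subst nn_integral_cmult_indicator) (auto simp: emeasure_eq_measure ennreal_mult mult.commute)
    also have "\<dots> \<le> (\<integral>\<^sup>+x. (\<integral>\<^sup>+e. ennreal (y / ((e - x)^2 + y^2)) * indicator {a-d..b+d} e \<partial>lborel) \<partial>\<gamma>)"
    proof (intro nn_integral_mono)
      fix x
      show "ennreal (2 * arctan k) * indicator {a..b} x \<le> (\<integral>\<^sup>+e. ennreal (y / ((e - x)^2 + y^2)) * indicator {a-d..b+d} e \<partial>lborel)"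
      proof (cases "x \<in> {a..b}")
        case True
        have "k \<le> (b + d - x) / y" "(a - d - x) / y \<le> - k"
          using True y(1) unfolding y(2)[symmetric] by (auto simp: divide_simps)
        then have "arctan k \<le> arctan ((b + d - x) / y)" "arctan ((a - d - x) / y) \<le> arctan (-k)"
          by (simp_all only: arctan_le_iff)
        then have "2 * arctan k \<le> arctan ((b + d - x) / y) - arctan ((a - d - x) / y)"
          unfolding arctan_minus by linarith
        then show ?thesis
          using True arctan_kernel_integral[OF y(1), of "a-d" "b+d" x] ab d by (simp add: ennreal_leI)
      qed simp
    qed
    also have "\<dots> = (\<integral>\<^sup>+e. (\<integral>\<^sup>+x. ennreal (y / ((e - x)^2 + y^2)) * indicator {a-d..b+d} e \<partial>\<gamma>) \<partial>lborel)"
      by (rule PL.Fubini'[symmetric]) measurable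
    also have "\<dots> \<le> (\<integral>\<^sup>+e. ennreal (pi * C) * indicator {a-d..b+d} e \<partial>lborel)"
      using p by (intro nn_integral_mono) (auto simp: indicator_def)
    also have "\<dots> = ennreal (pi * C * (b - a + 2 * d))"
    proof -
      have "(\<integral>\<^sup>+e. ennreal (pi * C) * indicator {a-d..b+d} e \<partial>lborel) = ennreal (pi * C) * ennreal (b - a + 2 * d)"
        using ab d by (subst nn_integral_cmult_indicator) (auto simp: algebra_simps)
      then show ?thesis using C ab d by (simp add: ennreal_mult[of "pi * C" "b - a + 2 * d"])
    qed
    finally show ?thesis
      by (subst (asm) ennreal_le_iff) (use C ab d in auto)
  qed
  have pi_bound: "measure \<gamma> {a..b} * pi \<le> pi * C * (b - a + 2 * d)" if d: "d > 0" for d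
  proof (rule LIMSEQ_le_const2)
    have "(\<lambda>n. arctan (real (Suc n))) \<longlonglongrightarrow> pi / 2"
      by (rule filterlim_compose[OF tendsto_arctan_at_top]) (rule filterlim_compose[OF filterlim_real_sequentially filterlim_Suc])
    then have "(\<lambda>n. measure \<gamma> {a..b} * (2 * arctan (real (Suc n)))) \<longlonglongrightarrow> measure \<gamma> {a..b} * (2 * (pi / 2))"
      by (intro tendsto_intros)
    then show "(\<lambda>n. measure \<gamma> {a..b} * (2 * arctan (real (Suc n)))) \<longlonglongrightarrow> measure \<gamma> {a..b} * pi" by simp
  qed (use fin[OF d] in auto)
  have "measure \<gamma> {a..b} \<le> C * (b - a) + 2 * C * d" if "d > 0" for d
  proof -
    have "pi * measure \<gamma> {a..b} \<le> pi * (C * (b - a) + 2 * C * d)"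
      using pi_bound[OF that] by (simp add: algebra_simps)
    then show ?thesis by (simp only: mult_le_cancel_left_pos pi_gt_zero)
  qed
  moreover have "((\<lambda>d. C * (b - a) + 2 * C * d) \<longlongrightarrow> C * (b - a) + 2 * C * 0) (at_right 0)"
    by (intro tendsto_intros)
  ultimately show ?thesis
    by (intro tendsto_lowerbound[where F = "at_right (0::real)"]) (auto simp: eventually_at_filter)
qed


text \<open>
  The complementary measure generated by \<open>C x - cdf x\<close> adds up with \<open>\<gamma>\<close> to \<open>C\<close> times
  Lebesgue measure on half-open intervals, hence on all Borel sets.
\<close>

lemma emeasure_le_lborel_of_interval_bound:
  fixes \<gamma> :: "real measure"
  assumes "prob_space \<gamma>" and s: "sets \<gamma> = sets borel" and C: "0 \<le> C"
    and bound: "\<And>a b. a \<le> b \<Longrightarrow> measure \<gamma> {a..b} \<le> C * (b - a)"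
    and A: "A \<in> sets borel"
  shows "emeasure \<gamma> A \<le> ennreal C * emeasure lborel A"
proof -
  interpret prob_space \<gamma> by fact
  interpret real_distribution \<gamma> by unfold_locales fact
  note [measurable_cong] = s
  define H where "H = (\<lambda>x. C * x - cdf \<gamma> x)"
  define \<nu> where "\<nu> = interval_measure H"
  have Ioc: "measure \<gamma> {a<..b} = cdf \<gamma> b - cdf \<gamma> a" if "a \<le> b" for a b
    using that cdf_diff_eq[of a b] by (cases "a = b") auto
  have H_mono: "H a \<le> H b" if "a \<le> b" for a b
  proof -
    have "measure \<gamma> {a<..b} \<le> measure \<gamma> {a..b}" by (intro finite_measure_mono) auto
    then show ?thesis using bound[OF that] Ioc[OF that] by (simp add: H_def algebra_simps)
  qed
  have H_cont: "continuous (at_right a) H" for a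
    unfolding H_def by (intro continuous_intros cdf_is_right_cont)
  have \<nu>_Ioc: "emeasure \<nu> {a<..b} = ennreal (H b - H a)" if "a \<le> b" for a b
    unfolding \<nu>_def using that H_mono H_cont by (intro emeasure_interval_measure_Ioc)
  have s\<nu>[measurable_cong]: "sets \<nu> = sets borel" by (simp add: \<nu>_def)
  have basic: "emeasure \<gamma> {a<..b} + emeasure \<nu> {a<..b} = ennreal C * emeasure lborel {a<..b}" for a b
  proof (cases "a \<le> b")
    case True
    have "emeasure \<gamma> {a<..b} + emeasure \<nu> {a<..b} = ennreal (cdf \<gamma> b - cdf \<gamma> a + (H b - H a))"
      using H_mono[OF True] Ioc[OF True] unfolding \<nu>_Ioc[OF True] emeasure_eq_measure
      by (subst ennreal_plus) (auto simp flip: Ioc[OF True])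
    also have "\<dots> = ennreal (C * (b - a))" by (simp add: H_def algebra_simps)
    finally show ?thesis using True C by (simp add: ennreal_mult)
  qed simp
  \<comment> \<open>On a bounded window the measures are finite, which permits the cancellation
    needed for complements in the induction over generated sets.\<close>
  have window: "emeasure \<gamma> (A \<inter> {-r<..r}) + emeasure \<nu> (A \<inter> {-r<..r}) = ennreal C * emeasure lborel (A \<inter> {-r<..r})"
    (is "?P A") for r :: real
  proof -
    let ?W = "{-r<..r}"
    have fin: "emeasure \<nu> X \<noteq> \<top>" "emeasure lborel X \<noteq> \<top>" if "X \<subseteq> ?W" for X
    proof -
      have "emeasure \<nu> X \<le> emeasure \<nu> ?W" "emeasure lborel X \<le> emeasure lborel ?W"
        using that by (intro emeasure_mono; simp)+
      moreover have "emeasure \<nu> ?W < \<top>" "emeasure lborel ?W < \<top>"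
        using \<nu>_Ioc[of "-r" r] by (cases "-r \<le> r"; simp add: top.not_eq_extremum)+
      ultimately show "emeasure \<nu> X \<noteq> \<top>" "emeasure lborel X \<noteq> \<top>" by (metis leD)+
    qed
    have bor: "sets borel = sigma_sets UNIV (range (\<lambda>(a, b). {a<..b::real}))"
      unfolding borel_sigma_sets_Ioc by (rule sets_measure_of) simp
    have "Int_stable (range (\<lambda>(a, b). {a<..b::real}))"
    proof (rule Int_stableI_image)
      fix p q :: "real \<times> real"
      show "\<exists>r\<in>UNIV. (case p of (a, b) \<Rightarrow> {a<..b}) \<inter> (case q of (a, b) \<Rightarrow> {a<..b}) = (case r of (a, b) \<Rightarrow> {a<..b})"
        by (cases p; cases q) (auto intro!: bexI[of _ "(max (fst p) (fst q), min (snd p) (snd q))"])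
    qed
    moreover have "range (\<lambda>(a, b). {a<..b::real}) \<subseteq> Pow UNIV" by simp
    moreover have "A \<in> sigma_sets UNIV (range (\<lambda>(a, b). {a<..b::real}))" using A bor by simp
    ultimately show ?thesis
    proof (induction rule: sigma_sets_induct_disjoint)
      case (basic A)
      then obtain a b where A: "A = {a<..b}" by auto
      have "A \<inter> ?W = {max a (-r)<..min b r}" unfolding A by auto
      then show ?case using basic \<open>\<And>a b. emeasure \<gamma> {a<..b} + emeasure \<nu> {a<..b} = ennreal C * emeasure lborel {a<..b}\<close> by metis
    next
      case (compl A)
      have Am: "A \<in> sets borel" using compl(1) bor by simp
      have sub: "A \<inter> ?W \<subseteq> ?W" by simp
      have e: "(UNIV - A) \<inter> ?W = ?W - A \<inter> ?W" by auto
      have W: "emeasure P ?W = emeasure P (A \<inter> ?W) + emeasure P ((UNIV - A) \<inter> ?W)"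
        if "sets P = sets borel" for P :: "real measure"
        using Am that by (subst plus_emeasure) (auto intro!: arg_cong[where f = "emeasure P"])
      have "(emeasure \<gamma> (A \<inter> ?W) + emeasure \<nu> (A \<inter> ?W)) + (emeasure \<gamma> ((UNIV - A) \<inter> ?W) + emeasure \<nu> ((UNIV - A) \<inter> ?W))
         = emeasure \<gamma> ?W + emeasure \<nu> ?W"
        using W[OF s] W[OF s\<nu>] by (simp add: ac_simps)
      also have "\<dots> = ennreal C * emeasure lborel ?W" by (rule basic)
      also have "\<dots> = ennreal C * emeasure lborel (A \<inter> ?W) + ennreal C * emeasure lborel ((UNIV - A) \<inter> ?W)"
        using W[of lborel] by (simp add: distrib_left)
      finally have "ennreal C * emeasure lborel (A \<inter> ?W) + (emeasure \<gamma> ((UNIV - A) \<inter> ?W) + emeasure \<nu> ((UNIV - A) \<inter> ?W))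
        = ennreal C * emeasure lborel (A \<inter> ?W) + ennreal C * emeasure lborel ((UNIV - A) \<inter> ?W)"
        using compl(2) by simp
      moreover have "ennreal C * emeasure lborel (A \<inter> ?W) \<noteq> \<top>"
        using fin(2)[OF sub] by (simp add: ennreal_mult_eq_top_iff)
      ultimately show ?case by (simp add: ennreal_add_left_cancel)
    next
      case (union F)
      have Fm: "F i \<in> sets borel" for i using union(2) bor by auto
      have dj: "disjoint_family (\<lambda>i. F i \<inter> ?W)" using union(1) by (auto simp: disjoint_family_on_def)
      have S: "emeasure P ((\<Union>i. F i) \<inter> ?W) = (\<Sum>i. emeasure P (F i \<inter> ?W))" if "sets P = sets borel" for P :: "real measure"
        using Fm that by (subst suminf_emeasure[OF _ dj]) (auto intro!: arg_cong[where f = "emeasure P"])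
      show ?case
        unfolding S[OF s] S[OF s\<nu>] S[OF sets_lborel]
        using union(3) by (simp add: suminf_add ennreal_suminf_cmult)
    qed simp
  qed
  have le: "emeasure \<gamma> (A \<inter> {-real n<..real n}) \<le> ennreal C * emeasure lborel A" for n
  proof -
    have "emeasure \<gamma> (A \<inter> {-real n<..real n}) \<le> ennreal C * emeasure lborel (A \<inter> {-real n<..real n})"
      unfolding window[of "real n", symmetric] by simp
    also have "\<dots> \<le> ennreal C * emeasure lborel A"
      using A by (intro mult_left_mono emeasure_mono) auto
    finally show ?thesis .
  qed
  have lim: "(\<lambda>n. emeasure \<gamma> (A \<inter> {-real n<..real n})) \<longlonglongrightarrow> emeasure \<gamma> (\<Union>n. A \<inter> {-real n<..real n})"
    using A by (intro Lim_emeasure_incseq) (auto simp: incseq_def)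
  have U: "(\<Union>n. A \<inter> {-real n<..real n}) = A"
  proof -
    have "\<exists>n. - real n < x \<and> x \<le> real n" for x
    proof -
      obtain n where "\<bar>x\<bar> < real n" using reals_Archimedean2 by blast
      then show ?thesis by (intro exI[of _ n]) auto
    qed
    then show ?thesis by auto
  qed
  show ?thesis by (rule LIMSEQ_le_const2[OF lim[unfolded U]]) (use le in auto)
qed

text \<open>Domination gives absolute continuity, and a Radon-Nikodym density exceeding
  \<open>C\<close> on a set of positive measure would violate it there.\<close>

lemma bounded_density_of_emeasure_le:
  fixes \<gamma> :: "real measure"
  assumes s: "sets \<gamma> = sets borel" and C: "0 \<le> C"
    and bound: "\<And>A. A \<in> sets borel \<Longrightarrow> emeasure \<gamma> A \<le> ennreal C * emeasure lborel A"
  shows "absolutely_continuous lborel \<gamma>"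
    "\<exists>f :: real \<Rightarrow> real. f \<in> borel_measurable borel \<and> \<gamma> = density lborel (\<lambda>x. ennreal (f x)) \<and> (\<forall>x. 0 \<le> f x \<and> f x \<le> C)"
proof -
  show ac: "absolutely_continuous lborel \<gamma>"
    unfolding absolutely_continuous_def
  proof
    fix A :: "real set" assume A: "A \<in> null_sets lborel"
    then have "A \<in> sets borel" "emeasure lborel A = 0" by auto
    with bound[of A] show "A \<in> null_sets \<gamma>" by (auto simp: null_sets_def s)
  qed
  obtain g where g[measurable]: "g \<in> borel_measurable lborel" and \<gamma>: "density lborel g = \<gamma>"
    using sigma_finite_measure.Radon_Nikodym[OF sigma_finite_lborel ac] s by auto
  have le: "AE x in lborel. g x \<le> ennreal C"
  proof -
    \<comment> \<open>Cutting to bounded windows keeps both integrals finite, so that they may be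
      subtracted.\<close>
    have "AE x in lborel. x \<notin> {x. ennreal C < g x} \<inter> {-real n..real n}" for n
    proof -
      let ?A = "{x. ennreal C < g x} \<inter> {-real n..real n}"
      have A[measurable]: "?A \<in> sets borel" by measurable
      have gA: "(\<integral>\<^sup>+x. g x * indicator ?A x \<partial>lborel) = emeasure \<gamma> ?A"
        unfolding \<gamma>[symmetric] by (subst emeasure_density) auto
      have CA: "(\<integral>\<^sup>+x. ennreal C * indicator ?A x \<partial>lborel) = ennreal C * emeasure lborel ?A"
        by (rule nn_integral_cmult_indicator) simp
      have "emeasure lborel ?A \<le> emeasure lborel {-real n..real n}" by (intro emeasure_mono) auto
      also have "\<dots> < \<top>" by simp
      finally have fin: "ennreal C * emeasure lborel ?A \<noteq> \<top>"
        by (simp add: ennreal_mult_eq_top_iff)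
      have "(\<integral>\<^sup>+x. g x * indicator ?A x - ennreal C * indicator ?A x \<partial>lborel)
          = (\<integral>\<^sup>+x. g x * indicator ?A x \<partial>lborel) - (\<integral>\<^sup>+x. ennreal C * indicator ?A x \<partial>lborel)"
        using fin CA by (intro nn_integral_diff) (auto simp: indicator_def)
      also have "\<dots> = 0"
      proof -
        have "emeasure \<gamma> ?A < \<top>"
          using le_less_trans[OF bound[OF A]] fin by (simp add: less_top)
        then show ?thesis unfolding gA CA using bound[OF A] by (simp add: diff_eq_0_iff_ennreal)
      qed
      finally have "AE x in lborel. g x * indicator ?A x - ennreal C * indicator ?A x = 0"
        by (subst (asm) nn_integral_0_iff_AE) auto
      then show ?thesis
      proof (rule AE_mp, intro AE_I2 impI notI)
        fix x assume *: "g x * indicator ?A x - ennreal C * indicator ?A x = 0" and x: "x \<in> ?A"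
        then have "g x - ennreal C = 0" "ennreal C < g x" by auto
        then show False by (metis diff_gt_0_iff_gt_ennreal ennreal_less_top less_irrefl)
      qed
    qed
    then have "AE x in lborel. \<forall>n. x \<notin> {x. ennreal C < g x} \<inter> {-real n..real n}"
      by (simp add: AE_all_countable)
    then show ?thesis
    proof (rule AE_mp, intro AE_I2 impI)
      fix x assume *: "\<forall>n. x \<notin> {x. ennreal C < g x} \<inter> {-real n..real n}"
      obtain n where "\<bar>x\<bar> < real n" using reals_Archimedean2 by blast
      then have "x \<in> {-real n..real n}" by auto
      with * show "g x \<le> ennreal C" by (auto simp: not_less)
    qed
  qed
  \<comment> \<open>Truncating at \<open>C\<close> changes the density on a null set only and turns
    the almost everywhere bound into one at every point.\<close>
  define f where "f = (\<lambda>x. enn2real (min (g x) (ennreal C)))"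
  have ef: "ennreal (f x) = min (g x) (ennreal C)" for x
    unfolding f_def by (intro ennreal_enn2real) (simp add: min_less_iff_disj)
  have "f \<in> borel_measurable borel" unfolding f_def by measurable
  moreover have "\<gamma> = density lborel (\<lambda>x. ennreal (f x))"
    unfolding \<gamma>[symmetric] ef using le by (intro density_cong) (auto simp: min_def)
  moreover have "0 \<le> f x \<and> f x \<le> C" for x
    using C ef[of x] by (auto simp: f_def intro!: enn2real_leI)
  ultimately show "\<exists>f :: real \<Rightarrow> real. f \<in> borel_measurable borel \<and> \<gamma> = density lborel (\<lambda>x. ennreal (f x)) \<and> (\<forall>x. 0 \<le> f x \<and> f x \<le> C)"
    by blast
qed

subsection \<open>Poisson integrals of Toeplitz spectra\<close>

abbreviation scaled_toeplitz :: "(nat \<Rightarrow> real) \<Rightarrow> nat \<Rightarrow> real mat" where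
  "scaled_toeplitz a n \<equiv> (1 / sqrt (real n)) \<cdot>\<^sub>m toeplitz_mat a n"

text \<open>The integral of the kernel \<open>Im z / ((Re z - x)^2 + (Im z)^2)\<close> against the
  empirical spectral measure, as a deterministic function of the entries. The division is by the
  dimension \<open>n + 1\<close>, whereas the matrix is scaled by \<open>sqrt n\<close>.\<close>

definition poisson_trace :: "nat \<Rightarrow> complex \<Rightarrow> (nat \<Rightarrow> real) \<Rightarrow> real" where
  "poisson_trace n z a = - Im (matrix_trace (resolvent (scaled_toeplitz a n) z)) / real (n + 1)"

lemma scaled_toeplitz_symm: "scaled_toeplitz a n \<in> symm_mats (n + 1)"
  by (intro symm_mats_smult toeplitz_mat_symm)

lemma scaled_toeplitz_index_measurable:
  assumes "\<And>d. d \<le> n \<Longrightarrow> (\<lambda>\<omega>. X \<omega> d) \<in> borel_measurable M" "i < n + 1" "j < n + 1"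
  shows "(\<lambda>\<omega>. scaled_toeplitz (X \<omega>) n $$ (i,j)) \<in> borel_measurable M"
proof -
  let ?d = "if i \<le> j then j - i else i - j"
  have [measurable]: "(\<lambda>\<omega>. X \<omega> ?d) \<in> borel_measurable M" using assms by (intro assms(1)) auto
  have "scaled_toeplitz (X \<omega>) n $$ (i,j) = 1 / sqrt (real n) * X \<omega> ?d" for \<omega>
    using assms(2,3) by (simp add: toeplitz_mat_def)
  then show ?thesis by simp
qed

lemma poisson_trace_measurable:
  assumes "Im z > 0" "\<And>d. d \<le> n \<Longrightarrow> (\<lambda>\<omega>. X \<omega> d) \<in> borel_measurable M"
  shows "(\<lambda>\<omega>. poisson_trace n z (X \<omega>)) \<in> borel_measurable M"
proof -
  have [measurable]: "(\<lambda>\<omega>. matrix_trace (resolvent (scaled_toeplitz (X \<omega>) n) z)) \<in> borel_measurable M"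
    by (rule borel_measurable_trace_resolvent[OF scaled_toeplitz_symm assms(1)])
      (rule scaled_toeplitz_index_measurable[OF assms(2)])
  show ?thesis unfolding poisson_trace_def by measurable
qed

lemma poisson_trace_bound:
  assumes z: "Im z > 0"
  shows "\<bar>poisson_trace n z a\<bar> \<le> 1 / Im z"
proof -
  have "\<bar>Im (matrix_trace (resolvent (scaled_toeplitz a n) z))\<bar> \<le> real (n + 1) * (1 / Im z)"
    using cmod_trace_le[OF op_bound_resolvent[OF scaled_toeplitz_symm z]] abs_Im_le_cmod order_trans by blast
  then have "\<bar>Im (matrix_trace (resolvent (scaled_toeplitz a n) z))\<bar> / real (n + 1)
      \<le> real (n + 1) * (1 / Im z) / real (n + 1)"
    by (rule divide_right_mono) simp
  then show ?thesis by (simp add: poisson_trace_def abs_divide)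
qed

text \<open>Changing entry \<open>k\<close> perturbs the matrix by \<open>x / sqrt n\<close> times a
  Toeplitz matrix of norm at most 2: the two eights are \<open>2 * 2^2\<close> and
  \<open>2^3\<close>. Pulling \<open>1 / n\<close> out of the minimum leaves
  \<open>1 / sqrt n\<close> in front of the cube.\<close>

lemma poisson_trace_quadratic_approx:
  assumes z: "Im z > 0" and n: "n > 0"
  obtains c0 c1 c2 :: real where
    "\<And>x. \<bar>poisson_trace n z (a(k := x)) - (c0 + c1 * x + c2 * x^2)\<bar>
      \<le> (8 / Im z ^ 3 + 8 / Im z ^ 4) * (min (x^2) ((1 / sqrt (real n)) * \<bar>x\<bar>^3) / real n)"
proof -
  define c where "c = 1 / sqrt (real n)"
  have c: "c > 0" "c^2 = 1 / real n" using n by (auto simp: c_def power_divide)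
  define H where "H = c \<cdot>\<^sub>m toeplitz_mat (a(k := 0)) n"
  define E where "E = toeplitz_mat (\<lambda>i. if i = k then 1 else 0) n"
  have H: "H \<in> symm_mats (n+1)" unfolding H_def by (intro symm_mats_smult toeplitz_mat_symm)
  have E: "E \<in> symm_mats (n+1)" unfolding E_def by (rule toeplitz_mat_symm)
  obtain d0 d1 d2 where d: "\<And>y. \<bar>Im (matrix_trace (resolvent (H + y \<cdot>\<^sub>m E) z)) - (d0 + d1 * y + d2 * y^2)\<bar>
      \<le> real (n+1) * (2 * 2^2 / Im z ^ 3 + 2^3 / Im z ^ 4) * min (y^2) (\<bar>y\<bar>^3)"
    using trace_resolvent_quadratic_approx[OF H E symm_mats_add_smult[OF H E] z op_bound_toeplitz_unit[of n k, folded E_def]]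
    by metis
  let ?N = "real (n+1)"
  have "\<bar>poisson_trace n z (a(k := x)) - (- d0 / ?N + (- d1 * c / ?N) * x + (- d2 * c^2 / ?N) * x^2)\<bar>
      \<le> (8 / Im z ^ 3 + 8 / Im z ^ 4) * (min (x^2) (c * \<bar>x\<bar>^3) / real n)" for x
  proof -
    have "scaled_toeplitz (a(k := x)) n = H + (c * x) \<cdot>\<^sub>m E"
      unfolding H_def E_def c_def by (rule toeplitz_mat_fun_upd)
    then have "\<bar>poisson_trace n z (a(k := x)) - (- d0 / ?N + (- d1 * c / ?N) * x + (- d2 * c^2 / ?N) * x^2)\<bar>
        = \<bar>- (Im (matrix_trace (resolvent (H + (c * x) \<cdot>\<^sub>m E) z)) - (d0 + d1 * (c * x) + d2 * (c * x)^2)) / ?N\<bar>"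
      unfolding poisson_trace_def by (simp add: diff_divide_distrib add_divide_distrib power_mult_distrib)
    also have "\<dots> = \<bar>Im (matrix_trace (resolvent (H + (c * x) \<cdot>\<^sub>m E) z)) - (d0 + d1 * (c * x) + d2 * (c * x)^2)\<bar> / ?N"
      by (simp only: abs_divide abs_minus_cancel abs_of_nat)
    also have "\<dots> \<le> (?N * (2 * 2^2 / Im z ^ 3 + 2^3 / Im z ^ 4) * min ((c * x)^2) (\<bar>c * x\<bar>^3)) / ?N"
      by (intro divide_right_mono d) simp
    also have "\<dots> = (8 / Im z ^ 3 + 8 / Im z ^ 4) * min ((c * x)^2) (\<bar>c * x\<bar>^3)"
      by simp
    also have "min ((c * x)^2) (\<bar>c * x\<bar>^3) = c^2 * min (x^2) (c * \<bar>x\<bar>^3)"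
    proof -
      have "(c * x)^2 = c^2 * x^2" "\<bar>c * x\<bar>^3 = c^2 * (c * \<bar>x\<bar>^3)"
        using c(1) by (auto simp: abs_mult power_mult_distrib power2_eq_square power3_eq_cube)
      then show ?thesis by (simp only: min_mult_distrib_left zero_le_power2 if_True)
    qed
    also have "c^2 * min (x^2) (c * \<bar>x\<bar>^3) = min (x^2) (c * \<bar>x\<bar>^3) / real n"
      by (simp add: c(2))
    finally show ?thesis .
  qed
  then show ?thesis using that unfolding c_def by blast
qed

text \<open>There are \<open>n + 1\<close> exchanges, each costing a truncated moment divided by
  \<open>n\<close>. The leading 2 bounds \<open>(n + 1) / n\<close>.\<close>

lemma poisson_trace_universality:
  assumes z: "Im z > 0" and n: "n > 0"
    and \<nu>: "prob_space \<nu>" "sets \<nu> = sets borel" and i2: "integrable \<nu> (\<lambda>x. x^2)"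
    and m1: "(\<integral>x. x \<partial>\<nu>) = m" and m2: "(\<integral>x. x^2 \<partial>\<nu>) = 1 + m^2"
  defines "\<tau> \<equiv> (\<lambda>P :: real measure. \<integral>x. min (x^2) ((1 / sqrt (real n)) * \<bar>x\<bar>^3) \<partial>P)"
  shows "\<bar>(\<integral>a. poisson_trace n z a \<partial>PiM {..n} (\<lambda>_. \<nu>)) - (\<integral>a. poisson_trace n z a \<partial>PiM {..n} (\<lambda>_. gaussian m))\<bar>
    \<le> 2 * (8 / Im z ^ 3 + 8 / Im z ^ 4) * (\<tau> \<nu> + \<tau> (gaussian m))"
proof -
  define K where "K = 8 / Im z ^ 3 + 8 / Im z ^ 4"
  have K: "K \<ge> 0" using z by (simp add: K_def)
  define e where "e = K / real n * (\<tau> \<nu> + \<tau> (gaussian m))"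
  let ?m = "\<lambda>x. K * (min (x^2) ((1 / sqrt (real n)) * \<bar>x\<bar>^3) / real n)"
  have meas: "poisson_trace n z \<in> borel_measurable (PiM {..n} (\<lambda>_. borel))"
    by (rule poisson_trace_measurable[OF z]) (rule measurable_component_singleton, simp)
  have swap: "\<bar>(\<integral>x. poisson_trace n z (a(k := x)) \<partial>\<nu>) - (\<integral>x. poisson_trace n z (a(k := x)) \<partial>gaussian m)\<bar> \<le> e" for k a
  proof -
    obtain c0 c1 c2 where approx: "\<And>x. \<bar>poisson_trace n z (a(k := x)) - (c0 + c1 * x + c2 * x^2)\<bar> \<le> ?m x"
      using poisson_trace_quadratic_approx[OF z n, of a k] unfolding K_def by blast
    have "\<bar>(\<integral>x. poisson_trace n z (a(k := x)) \<partial>\<nu>) - (\<integral>x. poisson_trace n z (a(k := x)) \<partial>gaussian m)\<bar>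
        \<le> (\<integral>x. ?m x \<partial>\<nu>) + (\<integral>x. ?m x \<partial>gaussian m)"
    proof (rule moment_matching_replacement[OF \<nu> gaussian_prob_space _ i2 gaussian_moments(1) _ _ _ poisson_trace_bound[OF z] _ _ _ approx])
      show "(\<lambda>x. poisson_trace n z (a(k := x))) \<in> borel_measurable borel"
        by (rule poisson_trace_measurable[OF z]) simp
      show "?m x \<le> (K / real n) * x^2" for x :: real
      proof -
        have "?m x = K / real n * min (x^2) ((1 / sqrt (real n)) * \<bar>x\<bar>^3)" by simp
        also have "\<dots> \<le> (K / real n) * x^2" using K by (intro mult_left_mono) auto
        finally show ?thesis .
      qed
      show "0 \<le> ?m x" for x using K by (intro mult_nonneg_nonneg divide_nonneg_nonneg) auto
    qed (use m1 m2 gaussian_moments in auto)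
    also have "\<dots> = e" by (simp add: e_def \<tau>_def algebra_simps)
    finally show ?thesis .
  qed
  have t: "\<tau> P \<ge> 0" for P unfolding \<tau>_def by (intro Bochner_Integration.integral_nonneg) auto
  have "\<bar>(\<integral>a. poisson_trace n z a \<partial>PiM {..n} (\<lambda>_. \<nu>)) - (\<integral>a. poisson_trace n z a \<partial>PiM {..n} (\<lambda>_. gaussian m))\<bar>
      \<le> real (card {..n}) * e"
    by (rule lindeberg_replacement[OF _ \<nu> gaussian_prob_space _ meas poisson_trace_bound[OF z] swap]) auto
  also have "\<dots> = (real (n + 1) / real n) * (K * (\<tau> \<nu> + \<tau> (gaussian m)))" by (simp add: e_def)
  also have "\<dots> \<le> 2 * (K * (\<tau> \<nu> + \<tau> (gaussian m)))"
    using n K t[of \<nu>] t[of "gaussian m"] by (intro mult_right_mono) (auto simp: divide_simps)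
  finally show ?thesis by (simp only: K_def mult.assoc)
qed

lemma toeplitz_mat_line:
  "c \<cdot>\<^sub>m toeplitz_mat (\<lambda>d\<in>{..n}. g d + t * u d) n = c \<cdot>\<^sub>m toeplitz_mat g n + t \<cdot>\<^sub>m toeplitz_mat (\<lambda>d. c * u d) n"
  by (intro eq_matI) (auto simp: toeplitz_mat_def algebra_simps)

text \<open>Each of the \<open>n + 1\<close> Fourier energies has Gaussian mean at most
  \<open>2 pi exp (1/2)\<close>, by \<open>spectral_averaging\<close> along lines and
  \<open>gaussian_directional_smoothing\<close>; the normalised trace is their average.\<close>

lemma poisson_trace_gaussian_bound:
  assumes z: "Im z > 0" and n: "n > 0"
  shows "(\<integral>a. poisson_trace n z a \<partial>PiM {..n} (\<lambda>_. gaussian m)) \<le> 2 * pi * exp (1/2)"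
proof -
  let ?P = "PiM {..n} (\<lambda>_. gaussian m)"
  interpret P: prob_space ?P by (intro prob_space_PiM gaussian_prob_space)
  have sP[measurable_cong]: "sets ?P = sets (PiM {..n} (\<lambda>_. borel))" by (intro sets_PiM_cong) auto
  let ?N = "n + 1"
  let ?h = "\<lambda>j a. plane_energy (scaled_toeplitz a n) z (dft_cos ?N j) (dft_sin ?N j)"
  \<comment> \<open>The factor \<open>sqrt n\<close> undoes the scaling, so that a shift by
    \<open>t * ?u j\<close> moves the scaled matrix by exactly \<open>t\<close> times the
    \<open>j\<close>-th projection.\<close>
  let ?u = "\<lambda>j d. sqrt (real n) * (cos (2 * pi * real j * real d / real ?N) / real ?N)"
  have h0: "?h j a \<ge> 0" for j a by (rule plane_energy_nonneg[OF scaled_toeplitz_symm z]) auto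
  have hm[measurable]: "?h j \<in> borel_measurable (PiM {..n} (\<lambda>_. borel))" for j
    by (rule borel_measurable_plane_energy[OF scaled_toeplitz_symm z scaled_toeplitz_index_measurable])
      (auto intro!: measurable_component_singleton)
  have line: "scaled_toeplitz (\<lambda>d\<in>{..n}. g d + t * ?u j d) n
      = scaled_toeplitz g n + t \<cdot>\<^sub>m plane_mat ?N (dft_cos ?N j) (dft_sin ?N j)" for g t j
  proof -
    have "(\<lambda>d. 1 / sqrt (real n) * ?u j d) = (\<lambda>d. cos (2 * pi * real j * real d / real ?N) / real ?N)"
      using n by simp
    then show ?thesis unfolding toeplitz_mat_line plane_mat_dft_toeplitz by (simp only:)
  qed
  have u: "(\<Sum>d\<le>n. (?u j d)^2) \<le> 1" for j
  proof -
    have "(\<Sum>d\<le>n. (?u j d)^2) \<le> (\<Sum>d\<le>n. real n / (real ?N)^2)"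
    proof (intro sum_mono)
      fix d
      have "(?u j d)^2 = real n / (real ?N)^2 * (cos (2 * pi * real j * real d / real ?N))^2"
        by (simp add: power_mult_distrib power_divide)
      also have "\<dots> \<le> real n / (real ?N)^2 * 1"
        by (intro mult_left_mono) (auto simp: abs_square_le_1)
      finally show "(?u j d)^2 \<le> real n / (real ?N)^2" by simp
    qed
    also have "\<dots> = real n / real ?N" by (simp add: power2_eq_square)
    also have "\<dots> \<le> 1" by simp
    finally show ?thesis .
  qed
  have each: "(\<integral>\<^sup>+a. ennreal (?h j a) \<partial>?P) \<le> ennreal (exp (1/2) * (2 * pi))" for j
  proof (rule gaussian_directional_smoothing[OF _ _ u])
    show "(\<lambda>a. ennreal (?h j a)) \<in> borel_measurable (PiM {..n} (\<lambda>_. borel))" by measurable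
    show "(\<integral>\<^sup>+t. ennreal (?h j (\<lambda>d\<in>{..n}. g d + t * ?u j d)) * indicator {-1..1} t \<partial>lborel) \<le> ennreal (2 * pi)" for g
      unfolding line by (rule spectral_averaging[OF scaled_toeplitz_symm z]) auto
  qed auto
  have pt: "poisson_trace n z a = (\<Sum>j<?N. ?h j a) / real ?N" for a
    unfolding poisson_trace_def by (subst sum_plane_energy_dft[OF scaled_toeplitz_symm z]) auto
  have "ennreal (poisson_trace n z a) = ennreal (1 / real ?N) * (\<Sum>j<?N. ennreal (?h j a))" for a
  proof -
    have "ennreal (poisson_trace n z a) = ennreal (1 / real ?N * (\<Sum>j<?N. ?h j a))"
      unfolding pt by (simp only: times_divide_eq_left mult_1_left)
    also have "\<dots> = ennreal (1 / real ?N) * ennreal (\<Sum>j<?N. ?h j a)"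
      by (rule ennreal_mult') simp
    also have "ennreal (\<Sum>j<?N. ?h j a) = (\<Sum>j<?N. ennreal (?h j a))"
      by (rule sum_ennreal[symmetric]) (rule h0)
    finally show ?thesis .
  qed
  then have "(\<integral>\<^sup>+a. ennreal (poisson_trace n z a) \<partial>?P) = (\<integral>\<^sup>+a. ennreal (1 / real ?N) * (\<Sum>j<?N. ennreal (?h j a)) \<partial>?P)"
    by simp
  also have "\<dots> = ennreal (1 / real ?N) * (\<Sum>j<?N. \<integral>\<^sup>+a. ennreal (?h j a) \<partial>?P)"
  proof -
    have hm': "(\<lambda>a. ennreal (?h j a)) \<in> borel_measurable ?P" for j by measurable
    show ?thesis
      by (subst nn_integral_cmult[OF borel_measurable_sum[OF hm']], subst nn_integral_sum[OF hm']) (rule refl)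
  qed
  also have "\<dots> \<le> ennreal (1 / real ?N) * (\<Sum>j<?N. ennreal (exp (1/2) * (2 * pi)))"
    by (intro mult_left_mono sum_mono each) auto
  also have "\<dots> = ennreal (exp (1/2) * (2 * pi))"
  proof -
    have "ennreal (1 / real ?N) * of_nat ?N = ennreal (1 / real ?N * real ?N)"
      unfolding ennreal_of_nat_eq_real_of_nat by (rule ennreal_mult'[symmetric]) simp
    also have "\<dots> = 1" by simp
    finally show ?thesis by (simp only: sum_constant card_lessThan mult.assoc[symmetric] mult_1_left)
  qed
  finally have le: "(\<integral>\<^sup>+a. ennreal (poisson_trace n z a) \<partial>?P) \<le> ennreal (exp (1/2) * (2 * pi))" .
  have meas: "poisson_trace n z \<in> borel_measurable (PiM {..n} (\<lambda>_. borel))"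
    by (rule poisson_trace_measurable[OF z]) (rule measurable_component_singleton, simp)
  have nn: "poisson_trace n z a \<ge> 0" for a unfolding pt using h0 by (intro divide_nonneg_nonneg sum_nonneg) auto
  have "integrable ?P (poisson_trace n z)"
    using meas poisson_trace_bound[OF z] by (intro P.integrable_const_bound[of _ "1 / Im z"]) auto
  then have "(\<integral>\<^sup>+a. ennreal (poisson_trace n z a) \<partial>?P) = ennreal (\<integral>a. poisson_trace n z a \<partial>?P)"
    using nn by (intro nn_integral_eq_integral) auto
  with le show ?thesis by (simp add: mult_ac)
qed

theorem theorem1:
  fixes M :: "'w measure" and a :: "nat \<Rightarrow> 'w \<Rightarrow> real" and \<gamma> :: "real measure"
  assumes "prob_space M"
    and "\<And>j. a j \<in> borel_measurable M"
    and "prob_space.indep_vars M (\<lambda>_. borel) a UNIV"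
    and "\<And>j. distr M borel (a j) = distr M borel (a 0)"
    and "integrable M (\<lambda>\<omega>. (a 0 \<omega>)^2)"
    and "prob_space.variance M (a 0) = 1"
    and "prob_space \<gamma>" and "sets \<gamma> = sets borel"
    and "AE \<omega> in M. weak_conv_m
           (\<lambda>n. empirical_eigen_dist ((1 / sqrt (real (Suc n))) \<cdot>\<^sub>m toeplitz_mat (\<lambda>j. a j \<omega>) (Suc n))) \<gamma>"
  shows "absolutely_continuous lborel \<gamma> \<and>
         (\<exists>f :: real \<Rightarrow> real. f \<in> borel_measurable borel \<and>
            \<gamma> = density lborel (\<lambda>x. ennreal (f x)) \<and>
            (\<forall>x. 0 \<le> f x \<and> f x \<le> 16 * sqrt 2 / pi \<and> f x \<le> 8))"
proof -
  interpret prob_space M by fact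
  note [measurable] = assms(2)
  define \<nu> where "\<nu> = distr M borel (a 0)"
  define m where "m = expectation (a 0)"
  have \<nu>: "prob_space \<nu>" "sets \<nu> = sets borel"
    unfolding \<nu>_def by (auto intro: prob_space_distr)
  have int1: "integrable M (a 0)"
    by (rule square_integrable_imp_integrable[OF _ assms(5)]) measurable
  have i2: "integrable \<nu> (\<lambda>x. x^2)"
    unfolding \<nu>_def using assms(5) by (simp add: integrable_distr_eq)
  have m1: "(\<integral>x. x \<partial>\<nu>) = m" by (simp add: \<nu>_def m_def integral_distr)
  have m2: "(\<integral>x. x^2 \<partial>\<nu>) = 1 + m^2"
    using variance_eq[OF int1 assms(5)] assms(6) by (simp add: \<nu>_def m_def integral_distr)
  \<comment> \<open>Independence and equal laws identify the joint law of the first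
    \<open>n + 1\<close> entries with the product measure used above.\<close>
  have law: "distr M (PiM {..n} (\<lambda>_. borel)) (\<lambda>\<omega>. \<lambda>i\<in>{..n}. a i \<omega>) = PiM {..n} (\<lambda>_. \<nu>)" for n
  proof -
    have "indep_vars (\<lambda>_. borel) a {..n}" using assms(3) by (rule indep_vars_subset) auto
    then have "distr M (PiM {..n} (\<lambda>_. borel)) (\<lambda>\<omega>. \<lambda>i\<in>{..n}. a i \<omega>) = PiM {..n} (\<lambda>i. distr M borel (a i))"
      by (subst (asm) indep_vars_iff_distr_eq_PiM') auto
    moreover have "(\<lambda>i. distr M borel (a i)) = (\<lambda>_. \<nu>)"
      unfolding \<nu>_def by (intro ext) (rule assms(4))
    ultimately show ?thesis by (simp only:)
  qed
  have poisson: "(\<integral>x. y / ((e - x)^2 + y^2) \<partial>\<gamma>) \<le> pi * (2 * exp (1/2))" if y: "y > 0" for e y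
  proof -
    define z where "z = Complex e y"
    have z: "Im z > 0" using y by (simp add: z_def)
    define f where "f = (\<lambda>x. y / ((e - x)^2 + y^2))"
    define G where "G = (\<lambda>n \<omega>. poisson_trace (Suc n) z (\<lambda>j. a j \<omega>))"
    have pos: "(e - x)^2 + y^2 > 0" for x using y by (simp add: add_nonneg_pos)
    have f_cont: "continuous_on UNIV f"
      unfolding f_def using pos by (intro continuous_intros) (metis less_irrefl)
    have f_bound: "\<bar>f x\<bar> \<le> 1 / y" for x
      using y pos[of x] by (simp add: f_def abs_of_nonneg divide_simps power2_eq_square)
    have emp: "(\<integral>x. f x \<partial>empirical_eigen_dist (scaled_toeplitz (\<lambda>j. a j \<omega>) (Suc n))) = G n \<omega>" for n \<omega>
      using empirical_eigen_dist_integral[OF scaled_toeplitz_symm _ z, of "Suc n" "\<lambda>j. a j \<omega>"]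
      by (simp add: f_def G_def poisson_trace_def z_def)
    have \<gamma>: "real_distribution \<gamma>"
      using assms(7,8) by (simp add: real_distribution_def real_distribution_axioms_def)
    \<comment> \<open>For fixed \<open>y > 0\<close> the Poisson kernel is bounded and continuous,
      hence a test function for weak convergence.\<close>
    have conv: "AE \<omega> in M. (\<lambda>n. G n \<omega>) \<longlonglongrightarrow> (\<integral>x. f x \<partial>\<gamma>)"
      using assms(9)
    proof (rule AE_mp, intro AE_I2 impI)
      fix \<omega>
      assume "weak_conv_m (\<lambda>n. empirical_eigen_dist (scaled_toeplitz (\<lambda>j. a j \<omega>) (Suc n))) \<gamma>"
      then have "(\<lambda>n. \<integral>x. f x \<partial>empirical_eigen_dist (scaled_toeplitz (\<lambda>j. a j \<omega>) (Suc n))) \<longlonglongrightarrow> (\<integral>x. f x \<partial>\<gamma>)"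
        using f_cont f_bound
        by (intro weak_conv_imp_integral_bdd_continuous_conv[OF real_distribution_empirical \<gamma>, where B = "1/y"])
          (auto simp: continuous_on_eq_continuous_at)
      then show "(\<lambda>n. G n \<omega>) \<longlonglongrightarrow> (\<integral>x. f x \<partial>\<gamma>)" unfolding emp .
    qed
    have G_meas[measurable]: "G n \<in> borel_measurable M" for n
      unfolding G_def by (rule poisson_trace_measurable[OF z]) simp
    \<comment> \<open>The bound \<open>1 / Im z\<close> dominates, so means converge to the
      deterministic limit.\<close>
    have lim: "(\<lambda>n. expectation (G n)) \<longlonglongrightarrow> (\<integral>\<omega>. (\<integral>x. f x \<partial>\<gamma>) \<partial>M)"
    proof (rule integral_dominated_convergence[OF _ _ _ conv])
      show "AE \<omega> in M. norm (G n \<omega>) \<le> 1 / Im z" for n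
        unfolding G_def using poisson_trace_bound[OF z] by simp
    qed auto
    define \<tau> where "\<tau> = (\<lambda>n (P :: real measure). \<integral>x. min (x^2) ((1 / sqrt (real (Suc n))) * \<bar>x\<bar>^3) \<partial>P)"
    define K where "K = 2 * (8 / Im z ^ 3 + 8 / Im z ^ 4)"
    have up: "expectation (G n) \<le> 2 * pi * exp (1/2) + K * (\<tau> n \<nu> + \<tau> n (gaussian m))" for n
    proof -
      let ?n = "Suc n"
      have meas: "poisson_trace ?n z \<in> borel_measurable (PiM {..?n} (\<lambda>_. borel))"
        by (rule poisson_trace_measurable[OF z]) (rule measurable_component_singleton, simp)
      \<comment> \<open>The matrix reads only the entries with index at most \<open>?n\<close>;
        restriction makes the argument a point of the product space.\<close>
      have restr: "poisson_trace ?n z (\<lambda>i\<in>{..?n}. a i \<omega>) = G n \<omega>" for \<omega>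
      proof -
        have "toeplitz_mat (\<lambda>i\<in>{..?n}. a i \<omega>) ?n = toeplitz_mat (\<lambda>i. a i \<omega>) ?n"
          by (intro eq_matI) (auto simp: toeplitz_mat_def)
        then show ?thesis by (simp add: G_def poisson_trace_def)
      qed
      have "(\<integral>x. poisson_trace ?n z x \<partial>PiM {..?n} (\<lambda>_. \<nu>)) = expectation (G n)"
        unfolding law[symmetric] by (subst integral_distr) (use meas in \<open>auto simp: restr\<close>)
      then show ?thesis
        using poisson_trace_universality[OF z _ \<nu> i2 m1 m2, of ?n] poisson_trace_gaussian_bound[OF z, of ?n m]
        by (simp add: K_def \<tau>_def abs_le_iff)
    qed
    have s0: "(\<lambda>n. 1 / sqrt (real (Suc n))) \<longlonglongrightarrow> 0"
      by (intro real_tendsto_divide_at_top[OF tendsto_const] filterlim_compose[OF sqrt_at_top]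
          filterlim_compose[OF filterlim_real_sequentially filterlim_Suc])
    have "(\<lambda>n. \<tau> n \<nu>) \<longlonglongrightarrow> 0" "(\<lambda>n. \<tau> n (gaussian m)) \<longlonglongrightarrow> 0"
      unfolding \<tau>_def
      by (rule truncated_third_moment_tendsto_0[OF \<nu>(2) i2 s0], simp)
        (rule truncated_third_moment_tendsto_0[OF _ gaussian_moments(1) s0], simp_all)
    then have "(\<lambda>n. 2 * pi * exp (1/2) + K * (\<tau> n \<nu> + \<tau> n (gaussian m))) \<longlonglongrightarrow> 2 * pi * exp (1/2) + K * (0 + 0)"
      by (intro tendsto_intros)
    then have "(\<integral>\<omega>. (\<integral>x. f x \<partial>\<gamma>) \<partial>M) \<le> 2 * pi * exp (1/2) + K * (0 + 0)"
      using lim up by (intro LIMSEQ_le) auto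
    then show ?thesis by (simp add: f_def prob_space mult_ac)
  qed
  have bound: "emeasure \<gamma> A \<le> ennreal (2 * exp (1/2)) * emeasure lborel A" if "A \<in> sets borel" for A
    by (rule emeasure_le_lborel_of_interval_bound[OF assms(7,8) _ _ that])
      (auto intro!: poisson_bound_interval[OF assms(7,8)] poisson)
  note density = bounded_density_of_emeasure_le[OF assms(8) _ bound]
  \<comment> \<open>The square of \<open>exp (1/2)\<close> is at most 3, so the bound obtained is at
    most 4, and 4 is below \<open>16 * sqrt 2 / pi\<close> because \<open>pi < 4\<close>.\<close>
  have "exp (1/2 :: real) \<le> 2"
  proof (rule power2_le_imp_le)
    have "(exp (1/2 :: real))^2 = exp 1" by (simp add: exp_double[symmetric])
    also have "\<dots> \<le> 3" by (rule exp_le)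
    finally show "(exp (1/2 :: real))^2 \<le> 2^2" by simp
  qed simp
  moreover have "4 \<le> 16 * sqrt 2 / pi"
  proof -
    have "4 * pi \<le> 16 * 1" using pi_less_4 by simp
    also have "\<dots> \<le> 16 * sqrt 2" by (intro mult_left_mono) auto
    finally show ?thesis by (simp add: le_divide_eq)
  qed
  ultimately have C: "2 * exp (1/2 :: real) \<le> 16 * sqrt 2 / pi" "2 * exp (1/2 :: real) \<le> 8"
    by linarith+
  show ?thesis
    using density C by (meson order_trans exp_ge_zero mult_nonneg_nonneg zero_le_numeral)
qed

end
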